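(* Let $\mathbf{G}_n$ be the $n$-dimensional random twisted hypercube, where at each recursive step the pair of copies of $\mathbf{G}_{m-1}$ may have an arbitrary joint distribution (with both marginals equal to the law of $\mathbf{G}_{m-1}$). Then \[\operatorname{diam}(\mathbf{G}_n) = (1+o(1))\frac{n}{\log_2 n}\] with high probability as $n\to\infty$, i.e. for every $\varepsilon>0$, $\mathbb{P}\big(|\operatorname{diam}(\mathbf{G}_n) - \tfrac{n}{\log_2 n}| \le \varepsilon \tfrac{n}{\log_2 n}\big)\to 1$ as $n\to\infty$.
   Context: The random twisted hypercube is defined recursively. $\mathbf{G}_1 = K_2$ (a single edge). For $m\ge 2$, one fixes an arbitrary distribution on pairs of graphs $(G^{(0)}_{m-1},G^{(1)}_{m-1})$ such that each $G^{(i)}_{m-1}$ has the same distribution as $\mathbf{G}_{m-1}$ (the two may be arbitrarily correlated, e.g. identical copies or independent copies); one samples such a pair, and independently of all previous choices chooses a perfect matching $M_m$ between $V(G^{(0)}_{m-1})$ and $V(G^{(1)}_{m-1})$ uniformly at random. Then $\mathbf{G}_m$ is the disjoint union of $G^{(0)}_{m-1}$ and $G^{(1)}_{m-1}$ together with the edges of $M_m$. Thus $\mathbf{G}_n$ is an $n$-regular graph on $2^n$ vertices. The joint distributions at each step may be chosen arbitrarily. $\operatorname{diam}$ denotes the graph diameter. *)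

theory Defs
  imports "HOL-Probability.Probability"
begin

text \<open>
  An undirected graph is a pair of a vertex set and a set of edges, where the edges of a
  simple graph are two-element subsets of the vertex set.
\<close>

type_synonym 'a ugraph = "'a set \<times> 'a set set"

definition verts :: "'a ugraph \<Rightarrow> 'a set" where
  "verts G = fst G"

definition edges :: "'a ugraph \<Rightarrow> 'a set set" where
  "edges G = snd G"

definition is_walk :: "'a ugraph \<Rightarrow> 'a \<Rightarrow> 'a list \<Rightarrow> 'a \<Rightarrow> bool" where
  "is_walk G u xs v \<longleftrightarrow>
     xs \<noteq> [] \<and> hd xs = u \<and> last xs = v \<and> set xs \<subseteq> verts G \<and>
     (\<forall>i. Suc i < length xs \<longrightarrow> {xs ! i, xs ! Suc i} \<in> edges G)"

text \<open>
  Walks are lists of vertices, so a walk has one edge fewer than its list has entries.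
  The infimum over the empty set is \<open>\<infinity>\<close>: vertices in different components are at distance
  \<open>\<infinity>\<close>, and a disconnected graph has diameter \<open>\<infinity>\<close>.
\<close>

definition graph_dist :: "'a ugraph \<Rightarrow> 'a \<Rightarrow> 'a \<Rightarrow> enat" where
  "graph_dist G u v = (INF xs\<in>{xs. is_walk G u xs v}. enat (length xs - 1))"

definition diam :: "'a ugraph \<Rightarrow> enat" where
  "diam G = (SUP u\<in>verts G. SUP v\<in>verts G. graph_dist G u v)"

definition map_graph :: "('a \<Rightarrow> 'b) \<Rightarrow> 'a ugraph \<Rightarrow> 'b ugraph" where
  "map_graph f G = (f ` verts G, (`) f ` edges G)"

definition perfect_matchings :: "'a set \<Rightarrow> 'a set \<Rightarrow> 'a set set set" where
  "perfect_matchings A B =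
     {M. M \<subseteq> {{a, b} | a b. a \<in> A \<and> b \<in> B} \<and> (\<forall>v\<in>A \<union> B. \<exists>!e. e \<in> M \<and> v \<in> e)}"

definition join_graphs :: "'a ugraph \<Rightarrow> 'a ugraph \<Rightarrow> 'a set set \<Rightarrow> 'a ugraph" where
  "join_graphs G H M = (verts G \<union> verts H, edges G \<union> edges H \<union> M)"

text \<open>
  The \<open>m\<close>-dimensional graph lives on the bit strings of length \<open>m\<close>. The two copies in the
  recursive step are made disjoint by prepending a bit.
\<close>

definition K2 :: "bool list ugraph" where
  "K2 = ({[False], [True]}, {{[False], [True]}})"

definition twisted_step ::
    "(bool list ugraph \<times> bool list ugraph) pmf \<Rightarrow> bool list ugraph pmf" where
  "twisted_step Q =
     bind_pmf Q (\<lambda>(G0, G1).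
       let H0 = map_graph (Cons False) G0; H1 = map_graph (Cons True) G1
       in map_pmf (join_graphs H0 H1) (pmf_of_set (perfect_matchings (verts H0) (verts H1))))"

text \<open>
  \<open>P n\<close> is the law of the \<open>n\<close>-dimensional random twisted hypercube, \<open>n \<ge> 1\<close>, and \<open>Q\<close> is
  the coupling of the two copies at step \<open>m\<close>, which is an arbitrary joint law with both
  marginals \<open>P (m - 1)\<close>. The value \<open>P 0\<close> plays no role.
\<close>

definition random_twisted_hypercube :: "(nat \<Rightarrow> bool list ugraph pmf) \<Rightarrow> bool" where
  "random_twisted_hypercube P \<longleftrightarrow>
     P 1 = return_pmf K2 \<and>
     (\<forall>m\<ge>2. \<exists>Q. map_pmf fst Q = P (m - 1) \<and> map_pmf snd Q = P (m - 1) \<and>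
                P m = twisted_step Q)"

end

theory Submission
  imports Defs "HOL-Real_Asymp.Real_Asymp"
begin

text \<open>
  The graph is \<open>n\<close>-regular on \<open>2\<^sup>n\<close> vertices, so balls of radius \<open>D\<close> have at most
  \<open>(n + 1)\<^sup>D\<close> vertices, which gives the lower bound on the diameter.

  For the upper bound fix a large constant \<open>r\<close>. Every ball of radius \<open>r\<close> in dimension \<open>m\<close> has
  at least \<open>m choose r\<close> vertices, whatever the matchings are. Suppose that all balls of radius
  \<open>s\<close> in dimension \<open>m\<close> have at least \<open>2 c\<close> vertices. The top matching of dimension \<open>m + 1\<close>
  throws \<open>2 c\<close> vertices of such a ball onto random vertices of the opposite half, and with
  probability \<open>1 - 8\<^sup>-\<^sup>c\<close> at least \<open>c\<close> of the balls of radius \<open>r\<close> around these are disjoint.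
  So at the cost of one dimension the radius grows by \<open>r + 1\<close> and the ball size by a factor of
  at least \<open>n\<^sup>r\<^sup>-\<^sup>1\<close>, because \<open>(m choose r) \<ge> 2 n\<^sup>r\<^sup>-\<^sup>1\<close>. Only the randomness of the top
  matching is used, hence the joint law of the two halves is irrelevant: it merely doubles the
  failure probability in each dimension. After about \<open>n / (2 (r - 1) log\<^sub>2 n) = o(n)\<close>
  dimensions all balls of radius \<open>(1 + o(1)) n / (2 log\<^sub>2 n)\<close> have at least \<open>n 2\<^sup>n\<^sup>/\<^sup>2\<close>
  vertices, and then the last matching joins any two of them that lie in opposite halves.
\<close>

section \<open>Balls, walks and the diameter\<close>

text \<open>Recursion on the radius lets balls grow edge by edge, avoiding the infimum in
  \<open>graph_dist\<close>. Membership in \<open>verts G\<close> is not demanded, so a centre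
  always lies in its ball.\<close>

primrec graph_ball :: "'a ugraph \<Rightarrow> 'a \<Rightarrow> nat \<Rightarrow> 'a set" where
  "graph_ball G v 0 = {v}"
| "graph_ball G v (Suc r) = {w. \<exists>x\<in>graph_ball G v r. w = x \<or> {x, w} \<in> edges G}"

lemma graph_ball_centre: "v \<in> graph_ball G v r"
  by (induction r) auto

lemma graph_ball_trans:
  assumes "y \<in> graph_ball G v r" "z \<in> graph_ball G y s"
  shows "z \<in> graph_ball G v (r + s)"
  using assms(2) by (induction s arbitrary: z) (use assms(1) in auto)

lemma graph_ball_1: "{x, y} \<in> edges G \<Longrightarrow> y \<in> graph_ball G x 1"
  by simp

lemma graph_ball_sym: "y \<in> graph_ball G v r \<Longrightarrow> v \<in> graph_ball G y r"
proof (induction r arbitrary: y)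
  case (Suc r)
  then obtain x where x: "x \<in> graph_ball G v r" "y = x \<or> {x, y} \<in> edges G" by auto
  have "x \<in> graph_ball G y 1" using x(2) by (auto simp: insert_commute)
  from graph_ball_trans[OF this Suc.IH[OF x(1)]] show ?case by simp
qed auto

lemma graph_ball_mono: "r \<le> s \<Longrightarrow> graph_ball G v r \<subseteq> graph_ball G v s"
  using graph_ball_trans[of _ G v r _ "s - r"] graph_ball_centre by fastforce

lemma graph_ball_subset_verts:
  assumes "\<Union> (edges G) \<subseteq> verts G" "v \<in> verts G"
  shows "graph_ball G v r \<subseteq> verts G"
  using assms by (induction r) auto

text \<open>Each vertex of a ball contributes at most itself and \<open>k\<close> neighbours to the
  next one. The crude factor \<open>k + 1\<close> suffices, as only its logarithm matters
  asymptotically.\<close>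

lemma card_graph_ball_le:
  assumes "\<Union> (edges G) \<subseteq> verts G" "finite (verts G)" "v \<in> verts G"
    and deg: "\<And>v. v \<in> verts G \<Longrightarrow> card {w. {v, w} \<in> edges G} \<le> k"
  shows "card (graph_ball G v r) \<le> (k + 1) ^ r"
proof (induction r)
  case (Suc r)
  note sub = graph_ball_subset_verts[OF assms(1,3)]
  have fin: "finite (graph_ball G v r)" using sub assms(2) finite_subset by blast
  have finN: "finite {w. {x, w} \<in> edges G}" for x
    by (rule finite_subset[OF _ assms(2)]) (use assms(1) in auto)
  have "graph_ball G v (Suc r) = (\<Union>x\<in>graph_ball G v r. insert x {w. {x, w} \<in> edges G})"
    by auto
  also have "card \<dots> \<le> (\<Sum>x\<in>graph_ball G v r. card (insert x {w. {x, w} \<in> edges G}))"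
    by (rule card_UN_le[OF fin])
  also have "\<dots> \<le> (\<Sum>x\<in>graph_ball G v r. k + 1)"
  proof (rule sum_mono)
    fix x assume "x \<in> graph_ball G v r"
    then show "card (insert x {w. {x, w} \<in> edges G}) \<le> k + 1"
      using deg[of x] sub finN[of x] card_insert_le_m1[of "k+1" "{w. {x, w} \<in> edges G}" x] by auto
  qed
  also have "\<dots> \<le> (k + 1) ^ Suc r" using mult_right_mono[OF Suc, of "k + 1"] by (simp add: mult.commute)
  finally show ?case .
qed simp

lemma walk_imp_graph_ball:
  "is_walk G u xs v \<Longrightarrow> v \<in> graph_ball G u (length xs - 1)"
proof (induction xs arbitrary: v rule: rev_induct)
  case (snoc y ys)
  show ?case
  proof (cases "ys = []")
    case True
    then show ?thesis using snoc.prems by (auto simp: is_walk_def)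
  next
    case False
    have adj: "{(ys @ [y]) ! i, (ys @ [y]) ! Suc i} \<in> edges G" if "i < length ys" for i
      using snoc.prems that unfolding is_walk_def by auto
    have "{ys ! i, ys ! Suc i} \<in> edges G" if "Suc i < length ys" for i
      using adj[of i] that by (simp add: nth_append)
    then have w: "is_walk G u ys (last ys)"
      using snoc.prems False by (simp add: is_walk_def)
    have y: "y = v" using snoc.prems by (simp add: is_walk_def)
    have "{last ys, v} \<in> edges G"
      using adj[of "length ys - 1"] False y by (simp add: nth_append last_conv_nth)
    then show ?thesis
      using snoc.IH[OF w] False by (cases ys rule: rev_cases) auto
  qed
qed (simp add: is_walk_def)

lemma graph_ball_imp_walk:
  assumes "\<Union> (edges G) \<subseteq> verts G" "u \<in> verts G" "v \<in> graph_ball G u r"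
  shows "\<exists>xs. is_walk G u xs v \<and> length xs \<le> Suc r"
  using assms(3)
proof (induction r arbitrary: v)
  case 0
  then show ?case using assms(2) by (intro exI[of _ "[u]"]) (auto simp: is_walk_def)
next
  case (Suc r)
  then obtain x where x: "x \<in> graph_ball G u r" "v = x \<or> {x, v} \<in> edges G" by auto
  from Suc.IH[OF x(1)] obtain xs where xs: "is_walk G u xs x" "length xs \<le> Suc r" by auto
  show ?case
  proof (cases "v = x")
    case True
    then show ?thesis using xs by (intro exI[of _ xs]) auto
  next
    case False
    then have e: "{x, v} \<in> edges G" using x by auto
    have last: "xs \<noteq> []" "xs ! (length xs - 1) = x"
      using xs(1) by (auto simp: is_walk_def last_conv_nth)
    have "{(xs @ [v]) ! i, (xs @ [v]) ! Suc i} \<in> edges G" if "i < length xs" for i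
    proof (cases "Suc i = length xs")
      case True
      then have "i = length xs - 1" by simp
      then show ?thesis using True last e by (simp add: nth_append)
    next
      case False
      then show ?thesis using that xs(1) by (simp add: nth_append is_walk_def)
    qed
    then have "is_walk G u (xs @ [v]) v"
      using xs(1) e assms(1) by (auto simp: is_walk_def)
    then show ?thesis using xs(2) by (intro exI[of _ "xs @ [v]"]) auto
  qed
qed

section \<open>Reading the diameter off from balls\<close>

lemma diam_le:
  assumes "\<Union> (edges G) \<subseteq> verts G"
    and "\<And>u v. u \<in> verts G \<Longrightarrow> v \<in> verts G \<Longrightarrow> v \<in> graph_ball G u r"
  shows "diam G \<le> enat r"
  unfolding diam_def
proof (intro SUP_least)
  fix u v assume uv: "u \<in> verts G" "v \<in> verts G"
  obtain xs where xs: "is_walk G u xs v" "length xs \<le> Suc r"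
    using graph_ball_imp_walk[OF assms(1) uv(1) assms(2)[OF uv]] by auto
  have "graph_dist G u v \<le> enat (length xs - 1)"
    unfolding graph_dist_def using xs(1) by (intro INF_lower) auto
  also have "\<dots> \<le> enat r" using xs(2) by simp
  finally show "graph_dist G u v \<le> enat r" .
qed

lemma verts_subset_graph_ball_diam:
  assumes "diam G = enat r" "u \<in> verts G"
  shows "verts G \<subseteq> graph_ball G u r"
proof
  fix v assume "v \<in> verts G"
  then have "graph_dist G u v \<le> enat r"
    unfolding assms(1)[symmetric] diam_def using assms(2) by (blast intro: SUP_upper2)
  \<comment> \<open>Strictness lets \<open>INF_less_iff\<close> extract an actual walk from the
    infimum.\<close>
  then have "graph_dist G u v < enat (Suc r)"
    using le_less_trans by fastforce
  then obtain xs where "is_walk G u xs v" "length xs - 1 < Suc r"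
    unfolding graph_dist_def by (auto simp: INF_less_iff)
  then show "v \<in> graph_ball G u r"
    using walk_imp_graph_ball graph_ball_mono[of "length xs - 1" r] by fastforce
qed

section \<open>Images of lists under random permutations\<close>

text \<open>Composing with the inverse of one such permutation \<open>\<sigma>0\<close> turns all of
  them into permutations fixing every entry of \<open>xs\<close>, that is, permutations of the
  remaining points.\<close>

lemma card_permutations_extending_le:
  assumes "finite V" "set xs \<subseteq> V" "distinct xs"
  shows "card {\<sigma>. \<sigma> permutes V \<and> map \<sigma> xs = ys} \<le> fact (card V - length xs)"
proof (cases "\<exists>\<sigma>0. \<sigma>0 permutes V \<and> map \<sigma>0 xs = ys")
  case True
  then obtain \<sigma>0 where s0: "\<sigma>0 permutes V" "map \<sigma>0 xs = ys" by blast
  have "card {\<sigma>. \<sigma> permutes V \<and> map \<sigma> xs = ys} \<le> card {\<tau>. \<tau> permutes V - set xs}"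
  proof (rule card_inj_on_le[of "\<lambda>\<sigma>. inv \<sigma>0 \<circ> \<sigma>"])
    have "inj (inv \<sigma>0)" using s0(1) by (simp add: bij_imp_bij_inv bij_is_inj permutes_bij)
    then show "inj_on (\<lambda>\<sigma>. inv \<sigma>0 \<circ> \<sigma>) {\<sigma>. \<sigma> permutes V \<and> map \<sigma> xs = ys}"
      by (auto simp: inj_on_def fun_eq_iff)
    show "(\<lambda>\<sigma>. inv \<sigma>0 \<circ> \<sigma>) ` {\<sigma>. \<sigma> permutes V \<and> map \<sigma> xs = ys} \<subseteq> {\<tau>. \<tau> permutes V - set xs}"
    proof safe
      fix \<sigma> assume s: "\<sigma> permutes V" "ys = map \<sigma> xs"
      have p: "(inv \<sigma>0 \<circ> \<sigma>) permutes V"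
        by (rule permutes_compose[OF s(1) permutes_inv[OF s0(1)]])
      have "(inv \<sigma>0 \<circ> \<sigma>) x = x" if "x \<in> set xs" for x
        using that s0 s(2) permutes_inverses(2)[OF s0(1)] by (metis comp_apply map_eq_conv)
      with p show "(inv \<sigma>0 \<circ> \<sigma>) permutes V - set xs"
        by (auto intro: permutes_superset)
    qed
    show "finite {\<tau>. \<tau> permutes V - set xs}" using assms by (intro finite_permutations) auto
  qed
  also have "\<dots> = fact (card (V - set xs))" using assms by (intro card_permutations) auto
  also have "card (V - set xs) = card V - length xs"
    using assms by (simp add: card_Diff_subset distinct_card)
  finally show ?thesis .
next
  case False
  then have "{\<sigma>. \<sigma> permutes V \<and> map \<sigma> xs = ys} = {}" by blast
  then show ?thesis by (simp only: card.empty)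
qed

text \<open>The quotient \<open>fact N / fact (N - a)\<close> is a product of \<open>a\<close>
  factors, each at least \<open>N - a\<close>.\<close>

lemma fact_ge_power_mult_fact: "a \<le> N \<Longrightarrow> (N - a) ^ a * fact (N - a) \<le> (fact N :: nat)"
proof (induction a)
  case (Suc a)
  have "N - a = Suc (N - Suc a)" using Suc.prems by simp
  then have "fact (N - a) = (N - a) * (fact (N - Suc a) :: nat)" by (metis fact_Suc of_nat_id)
  then have "(N - Suc a) ^ Suc a * fact (N - Suc a) \<le> (N - a) ^ a * (fact (N - a) :: nat)"
    using power_mono[of "N - Suc a" "N - a" a] by (auto simp: mult_ac intro!: mult_le_mono)
  then show ?case using Suc by simp
qed simp

text \<open>Each single value of \<open>map \<sigma> xs\<close> has probability at most
  \<open>fact (N - a) / fact N\<close>, where \<open>N = card V\<close> and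
  \<open>a = length xs\<close>. Up to replacing \<open>N\<close> by \<open>N - a\<close> this is
  independent uniform sampling, so probabilities reduce to counting lists.\<close>

lemma prob_permutation_list:
  assumes "finite V" "set xs \<subseteq> V" "distinct xs" "finite L" "length xs < card V"
  shows "measure_pmf.prob (pmf_of_set {\<sigma>. \<sigma> permutes V}) {\<sigma>. map \<sigma> xs \<in> L}
    \<le> card L / real (card V - length xs) ^ length xs"
proof -
  let ?a = "length xs" and ?N = "card V"
  let ?S = "{\<sigma>. \<sigma> permutes V}"
  have "?S \<inter> {\<sigma>. map \<sigma> xs \<in> L} = (\<Union>ys\<in>L. {\<sigma>. \<sigma> permutes V \<and> map \<sigma> xs = ys})" by auto
  then have "card (?S \<inter> {\<sigma>. map \<sigma> xs \<in> L}) \<le> (\<Sum>ys\<in>L. card {\<sigma>. \<sigma> permutes V \<and> map \<sigma> xs = ys})"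
    by (simp only: card_UN_le[OF assms(4)])
  also have "\<dots> \<le> (\<Sum>ys\<in>L. fact (?N - ?a))"
    by (intro sum_mono card_permutations_extending_le assms)
  finally have 1: "card (?S \<inter> {\<sigma>. map \<sigma> xs \<in> L}) \<le> card L * fact (?N - ?a)" by simp
  have 2: "real (?N - ?a) ^ ?a * fact (?N - ?a) \<le> fact ?N"
    using fact_ge_power_mult_fact[of ?a ?N] assms(5)
    by (metis (mono_tags) less_imp_le of_nat_fact of_nat_le_iff of_nat_mult of_nat_power)
  have pos: "real (?N - ?a) ^ ?a > 0" using assms(5) by simp
  have ne: "?S \<noteq> {}" using permutes_id by blast
  have "measure_pmf.prob (pmf_of_set ?S) {\<sigma>. map \<sigma> xs \<in> L} = card (?S \<inter> {\<sigma>. map \<sigma> xs \<in> L}) / fact ?N"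
    using finite_permutations[OF assms(1)] ne
    by (simp add: measure_pmf_of_set card_permutations[OF refl assms(1)])
  also have "\<dots> \<le> (real (card L) * fact (?N - ?a)) / fact ?N"
    using of_nat_mono[OF 1, where 'a = real] by (intro divide_right_mono) simp_all
  also have "\<dots> \<le> (real (card L) * fact (?N - ?a)) / (real (?N - ?a) ^ ?a * fact (?N - ?a))"
    using 2 pos by (intro divide_left_mono) (auto intro!: mult_pos_pos)
  also have "\<dots> = card L / real (?N - ?a) ^ ?a" by simp
  finally show ?thesis .
qed

section \<open>Counting lists of vertices whose sets overlap too much\<close>

lemma measure_pmf_mono:
  assumes "\<And>x. x \<in> set_pmf p \<Longrightarrow> x \<in> A \<Longrightarrow> x \<in> B"
  shows "measure_pmf.prob p A \<le> measure_pmf.prob p B"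
  by (rule measure_pmf.finite_measure_mono_AE) (use assms in \<open>auto simp: AE_measure_pmf_iff\<close>)

text \<open>Entries are chosen from left to right. The set allowed at a position in \<open>J\<close>
  may depend on the prefix, but its size is always at most \<open>z\<close>.\<close>

lemma card_constrained_lists_le:
  fixes Z :: "'a list \<Rightarrow> 'a set"
  assumes "finite V" and "\<And>ys. length ys < a \<Longrightarrow> set ys \<subseteq> V \<Longrightarrow> card (V \<inter> Z ys) \<le> z"
  shows "card {ys. length ys = a \<and> set ys \<subseteq> V \<and> (\<forall>j<a. j \<in> J \<longrightarrow> ys ! j \<in> Z (take j ys))}
    \<le> (\<Prod>j<a. if j \<in> J then z else card V)" (is "card (?L a) \<le> _")
  using assms(2)
proof (induction a)
  case 0
  have "?L 0 = {[]}" by auto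
  then show ?case by (simp only:) simp
next
  case (Suc a)
  define C where "C ys = (if a \<in> J then V \<inter> Z ys else V)" for ys
  have fin: "finite (?L a)"
    by (rule finite_subset[OF _ finite_lists_length_eq[OF assms(1), of a]]) auto
  have "?L (Suc a) \<subseteq> (\<lambda>(ys, y). ys @ [y]) ` (SIGMA ys:?L a. C ys)"
  proof
    fix xs assume xs: "xs \<in> ?L (Suc a)"
    then obtain ys y where [simp]: "xs = ys @ [y]" "length ys = a"
      by (cases xs rule: rev_cases) auto
    have con: "j \<in> J \<Longrightarrow> xs ! j \<in> Z (take j xs)" if "j < Suc a" for j using xs that by auto
    have "ys ! j \<in> Z (take j ys)" if "j < a" "j \<in> J" for j
      using con[of j] that by (simp add: nth_append)
    moreover have "a \<in> J \<Longrightarrow> y \<in> Z ys" using con[of a] by (simp add: nth_append)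
    ultimately show "xs \<in> (\<lambda>(ys, y). ys @ [y]) ` (SIGMA ys:?L a. C ys)"
      using xs by (auto simp: C_def intro!: rev_image_eqI[of "(ys, y)"])
  qed
  then have "card (?L (Suc a)) \<le> card (SIGMA ys:?L a. C ys)"
    using fin assms(1) by (intro surj_card_le) (auto simp: C_def)
  also have "\<dots> = (\<Sum>ys\<in>?L a. card (C ys))" using fin assms(1) by (intro card_SigmaI) (auto simp: C_def)
  also have "\<dots> \<le> (\<Sum>ys\<in>?L a. if a \<in> J then z else card V)"
    using Suc.prems by (intro sum_mono) (auto simp: C_def)
  also have "\<dots> = card (?L a) * (if a \<in> J then z else card V)" by simp
  also have "\<dots> \<le> (\<Prod>j<a. if j \<in> J then z else card V) * (if a \<in> J then z else card V)"
    using Suc by (intro mult_right_mono) auto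
  finally show ?case by simp
qed

text \<open>As \<open>z\<close> is at most \<open>N\<close>, positions of \<open>J\<close> in excess
  of \<open>c\<close> may be counted as free.\<close>

lemma prod_if_le:
  assumes "J \<subseteq> {..<2 * c}" "c \<le> card J" "z \<le> (N :: nat)"
  shows "(\<Prod>j<2 * c. if j \<in> J then z else N) \<le> z ^ c * N ^ c"
proof -
  have fJ: "finite J" using assms(1) finite_subset by blast
  have le: "card J \<le> 2 * c" using card_mono[OF _ assms(1)] by simp
  have "(\<Prod>j<2 * c. if j \<in> J then z else N) = z ^ card J * N ^ (2 * c - card J)"
    using assms(1) fJ by (simp add: prod.If_cases Int_absorb1 card_Diff_subset flip: Diff_eq)
  also have "\<dots> = z ^ c * (z ^ (card J - c) * N ^ (2 * c - card J))"
    using assms(2) by (simp flip: power_add add: mult.assoc[symmetric])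
  also have "\<dots> \<le> z ^ c * (N ^ (card J - c) * N ^ (2 * c - card J))"
    using assms(3) by (intro mult_le_mono power_mono) auto
  also have "\<dots> = z ^ c * N ^ c" using assms(2) le by (simp flip: power_add)
  finally show ?thesis .
qed

text \<open>
  An index is bad if its set meets an earlier one. A small union forces at least half of the
  indices to be bad, and each prescribed set of bad indices is unlikely.
\<close>

lemma card_small_union_lists_le:
  fixes B :: "'a \<Rightarrow> 'b set"
  assumes "finite V" and finB: "\<And>v. v \<in> V \<Longrightarrow> finite (B v)"
    and b: "\<And>v. v \<in> V \<Longrightarrow> b \<le> card (B v)"
    and D: "\<And>u. u \<in> V \<Longrightarrow> card {w \<in> V. B u \<inter> B w \<noteq> {}} \<le> D"
    and z: "2 * c * D \<le> card V"
  shows "card {ys. length ys = 2 * c \<and> set ys \<subseteq> V \<and> card (\<Union>y\<in>set ys. B y) < c * b}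
    \<le> 2 ^ (2 * c) * ((2 * c * D) ^ c * card V ^ c)"
proof -
  define Z where "Z ys = {w \<in> V. \<exists>u\<in>set ys. B u \<inter> B w \<noteq> {}}" for ys
  define L where "L J = {ys. length ys = 2 * c \<and> set ys \<subseteq> V \<and> (\<forall>j<2 * c. j \<in> J \<longrightarrow> ys ! j \<in> Z (take j ys))}" for J
  define \<J> where "\<J> = {J. J \<subseteq> {..<2 * c} \<and> c \<le> card J}"
  have sub: "{ys. length ys = 2 * c \<and> set ys \<subseteq> V \<and> card (\<Union>y\<in>set ys. B y) < c * b} \<subseteq> (\<Union>J\<in>\<J>. L J)"
  proof
    fix ys assume "ys \<in> {ys. length ys = 2 * c \<and> set ys \<subseteq> V \<and> card (\<Union>y\<in>set ys. B y) < c * b}"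
    then have ys: "length ys = 2 * c" "set ys \<subseteq> V" "card (\<Union>y\<in>set ys. B y) < c * b" by auto
    define J where "J = {j. j < 2 * c \<and> ys ! j \<in> Z (take j ys)}"
    have in_V: "ys ! j \<in> V" if "j < 2 * c" for j using that ys by (metis nth_mem subsetD)
    have disj: "B (ys ! i) \<inter> B (ys ! j) = {}" if "i < j" "j < 2 * c" "j \<notin> J" for i j
    proof -
      have "ys ! i \<in> set (take j ys)" using that ys(1) by (auto simp: in_set_conv_nth intro!: exI[of _ i])
      then show ?thesis using that in_V by (auto simp: J_def Z_def)
    qed
    have "c \<le> card J"
    \<comment> \<open>Otherwise more than \<open>c\<close> indices are good. Their sets are pairwise
      disjoint with at least \<open>b\<close> elements each, so the union already has size at least
      \<open>c * b\<close>.\<close>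
    proof (rule ccontr)
      assume "\<not> c \<le> card J"
      moreover have "card ({..<2 * c} - J) = 2 * c - card J"
        by (subst card_Diff_subset) (auto simp: J_def)
      ultimately have I: "c \<le> card ({..<2 * c} - J)" by simp
      have "c * b \<le> (\<Sum>j\<in>{..<2 * c} - J. b)" using I by simp
      also have "\<dots> \<le> (\<Sum>j\<in>{..<2 * c} - J. card (B (ys ! j)))"
        using b in_V by (intro sum_mono) auto
      also have "\<dots> = card (\<Union>j\<in>{..<2 * c} - J. B (ys ! j))"
      proof (rule card_UN_disjoint[symmetric])
        show "\<forall>i\<in>{..<2 * c} - J. \<forall>j\<in>{..<2 * c} - J. i \<noteq> j \<longrightarrow> B (ys ! i) \<inter> B (ys ! j) = {}"
          using disj by (metis DiffD1 DiffD2 Int_commute lessThan_iff linorder_neqE_nat)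
      qed (use finB in_V in auto)
      also have "\<dots> \<le> card (\<Union>y\<in>set ys. B y)"
        using finB ys by (intro card_mono) (auto intro!: bexI[OF _ nth_mem])
      finally show False using ys(3) by simp
    qed
    then have "J \<in> \<J>" by (auto simp: \<J>_def J_def)
    moreover have "ys \<in> L J" using ys by (auto simp: L_def J_def)
    ultimately show "ys \<in> (\<Union>J\<in>\<J>. L J)" by blast
  qed
  have fin\<J>: "finite \<J>" by (rule finite_subset[of _ "Pow {..<2 * c}"]) (auto simp: \<J>_def)
  have finL: "finite (L J)" for J
    by (rule finite_subset[OF _ finite_lists_length_eq[OF assms(1), of "2 * c"]]) (auto simp: L_def)
  \<comment> \<open>Fewer than \<open>2 * c\<close> entries come earlier, and each makes at most
    \<open>D\<close> vertices bad.\<close>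
  have Zle: "card (V \<inter> Z ys) \<le> 2 * c * D" if "length ys < 2 * c" "set ys \<subseteq> V" for ys
  proof -
    have "card (V \<inter> Z ys) \<le> card (\<Union>u\<in>set ys. {w \<in> V. B u \<inter> B w \<noteq> {}})"
      using assms(1) by (intro card_mono) (auto simp: Z_def)
    also have "\<dots> \<le> (\<Sum>u\<in>set ys. card {w \<in> V. B u \<inter> B w \<noteq> {}})" by (rule card_UN_le) simp
    also have "\<dots> \<le> (\<Sum>u\<in>set ys. D)" using D that by (intro sum_mono) auto
    also have "\<dots> \<le> 2 * c * D" using that card_length[of ys] by (auto intro: mult_le_mono)
    finally show ?thesis .
  qed
  have "card {ys. length ys = 2 * c \<and> set ys \<subseteq> V \<and> card (\<Union>y\<in>set ys. B y) < c * b} \<le> card (\<Union>J\<in>\<J>. L J)"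
    using sub fin\<J> finL by (intro card_mono) auto
  also have "\<dots> \<le> (\<Sum>J\<in>\<J>. card (L J))" by (rule card_UN_le[OF fin\<J>])
  also have "\<dots> \<le> (\<Sum>J\<in>\<J>. (2 * c * D) ^ c * card V ^ c)"
  proof (rule sum_mono)
    fix J assume "J \<in> \<J>"
    then show "card (L J) \<le> (2 * c * D) ^ c * card V ^ c"
      using order_trans[OF card_constrained_lists_le[OF assms(1) Zle] prod_if_le] z
      by (auto simp: L_def \<J>_def)
  qed
  also have "\<dots> = card \<J> * ((2 * c * D) ^ c * card V ^ c)" by simp
  \<comment> \<open>The union bound runs over at most \<open>2 ^ (2 * c)\<close> sets of bad
    indices.\<close>
  also have "card \<J> \<le> card (Pow {..<2 * c})" by (intro card_mono) (auto simp: \<J>_def)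
  then have "card \<J> * ((2 * c * D) ^ c * card V ^ c) \<le> 2 ^ (2 * c) * ((2 * c * D) ^ c * card V ^ c)"
    by (intro mult_right_mono) (simp_all add: card_Pow)
  finally show ?thesis .
qed

text \<open>The constant 256: dividing the count \<open>4 ^ c * (2 * c * D) ^ c * N ^ c\<close> by
  \<open>(N / 2) ^ (2 * c)\<close> leaves the \<open>c\<close>-th power of
  \<open>32 * c * D / N\<close>, which is at most 1/8 once \<open>N\<close> is at least
  \<open>256 * c * D\<close>.\<close>

lemma prob_permutation_small_union:
  fixes B :: "'a \<Rightarrow> 'b set"
  assumes "finite V" and finB: "\<And>v. v \<in> V \<Longrightarrow> finite (B v)"
    and b: "\<And>v. v \<in> V \<Longrightarrow> b \<le> card (B v)"
    and D: "\<And>u. u \<in> V \<Longrightarrow> card {w \<in> V. B u \<inter> B w \<noteq> {}} \<le> D"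
    and z: "256 * c * D \<le> card V" and "c > 0" "D > 0"
    and xs: "set xs \<subseteq> V" "distinct xs" "length xs = 2 * c"
  shows "measure_pmf.prob (pmf_of_set {\<sigma>. \<sigma> permutes V}) {\<sigma>. card (\<Union>x\<in>set xs. B (\<sigma> x)) < c * b}
    \<le> (1 / 8) ^ c"
proof -
  let ?N = "card V"
  define L where "L = {ys. length ys = 2 * c \<and> set ys \<subseteq> V \<and> card (\<Union>y\<in>set ys. B y) < c * b}"
  have finL: "finite L"
    by (rule finite_subset[OF _ finite_lists_length_eq[OF assms(1), of "2 * c"]]) (auto simp: L_def)
  have "c * 1 \<le> c * D" using \<open>D > 0\<close> by (intro mult_le_mono) auto
  then have N: "256 * c \<le> ?N" using z by linarith
  have ne: "{\<sigma>. \<sigma> permutes V} \<noteq> {}" using permutes_id by blast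
  have "measure_pmf.prob (pmf_of_set {\<sigma>. \<sigma> permutes V}) {\<sigma>. card (\<Union>x\<in>set xs. B (\<sigma> x)) < c * b}
    \<le> measure_pmf.prob (pmf_of_set {\<sigma>. \<sigma> permutes V}) {\<sigma>. map \<sigma> xs \<in> L}"
    using finite_permutations[OF assms(1)] ne xs
    by (intro measure_pmf_mono) (auto simp: L_def permutes_in_image)
  also have "\<dots> \<le> card L / real (?N - 2 * c) ^ (2 * c)"
    using prob_permutation_list[OF assms(1) xs(1,2) finL] xs(3) N \<open>c > 0\<close> by auto
  also have "\<dots> \<le> (4 * (2 * c * D) * ?N) ^ c / real (?N - 2 * c) ^ (2 * c)"
  proof (rule divide_right_mono)
    have "card L \<le> 2 ^ (2 * c) * ((2 * c * D) ^ c * card V ^ c)"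
      unfolding L_def using z by (intro card_small_union_lists_le assms) auto
    also have "\<dots> = (2 ^ 2 * (2 * c * D) * ?N) ^ c"
      by (simp only: power_mult power_mult_distrib mult.assoc)
    also have "2 ^ 2 = (4 :: nat)" by simp
    finally show "real (card L) \<le> real ((4 * (2 * c * D) * ?N) ^ c)" by (simp only: of_nat_le_iff)
  qed simp
  also have "\<dots> = (real (4 * (2 * c * D) * ?N) / real (?N - 2 * c) ^ 2) ^ c"
    by (simp add: power_divide power_mult)
  also have "\<dots> \<le> (1 / 8) ^ c"
  proof (rule power_mono)
    have h: "real ?N / 2 \<le> real (?N - 2 * c)" using N by (simp add: of_nat_diff)
    have Np: "real ?N > 0" using N \<open>c > 0\<close> by linarith
    have "real (4 * (2 * c * D) * ?N) * 8 \<le> (real ?N / 2) ^ 2"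
    proof -
      have "real (256 * c * D) * ?N \<le> real ?N * ?N" using z by (intro mult_right_mono) (simp_all only: of_nat_le_iff of_nat_0_le_iff)
      then show ?thesis by (simp add: power2_eq_square)
    qed
    also have "\<dots> \<le> real (?N - 2 * c) ^ 2" using h by (intro power_mono) auto
    finally have "real (4 * (2 * c * D) * ?N) * 8 \<le> real (?N - 2 * c) ^ 2" .
    moreover have "real (?N - 2 * c) > 0" using h Np by linarith
    ultimately show "real (4 * (2 * c * D) * ?N) / real (?N - 2 * c) ^ 2 \<le> 1 / 8"
      by (simp add: divide_simps)
  qed simp
  finally show ?thesis .
qed

text \<open>\<open>T\<close> has twice as many points as \<open>xs\<close> to offset the denominator
  \<open>N - c\<close> of \<open>prob_permutation_list\<close>: the ratio of
  \<open>N - 2 * c\<close> to \<open>N - c\<close> is still at most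
  \<open>1 - c / N\<close>.\<close>

lemma prob_permutation_avoids:
  assumes "finite V" "T \<subseteq> V" "card T = 2 * c" "set xs \<subseteq> V" "distinct xs" "length xs = c" "c > 0"
  shows "measure_pmf.prob (pmf_of_set {\<sigma>. \<sigma> permutes V}) {\<sigma>. \<sigma> ` set xs \<inter> T = {}}
    \<le> exp (- (real c ^ 2 / card V))"
proof -
  let ?N = "card V"
  define L where "L = {ys. set ys \<subseteq> V - T \<and> length ys = c}"
  have N: "2 * c \<le> ?N" using card_mono[OF assms(1,2)] assms(3) by simp
  have finL: "finite L" unfolding L_def using assms(1) by (intro finite_lists_length_eq) auto
  have cardL: "card L = (?N - 2 * c) ^ c"
    unfolding L_def using assms by (subst card_lists_length_eq) (auto simp: card_Diff_subset finite_subset)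
  have ne: "{\<sigma>. \<sigma> permutes V} \<noteq> {}" using permutes_id by blast
  have "measure_pmf.prob (pmf_of_set {\<sigma>. \<sigma> permutes V}) {\<sigma>. \<sigma> ` set xs \<inter> T = {}}
    \<le> measure_pmf.prob (pmf_of_set {\<sigma>. \<sigma> permutes V}) {\<sigma>. map \<sigma> xs \<in> L}"
    using finite_permutations[OF assms(1)] ne assms
    by (intro measure_pmf_mono) (auto simp: L_def permutes_in_image)
  also have "\<dots> \<le> card L / real (?N - c) ^ c"
    using prob_permutation_list[OF assms(1,4,5) finL] assms N by auto
  also have "\<dots> = (real (?N - 2 * c) / real (?N - c)) ^ c"
    by (simp add: cardL power_divide)
  also have "\<dots> \<le> exp (- (real c / ?N)) ^ c"
  proof (rule power_mono)
    have p: "real ?N - real c > 0" using N \<open>c > 0\<close> by linarith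
    have "real (?N - 2 * c) / real (?N - c) = 1 - real c / (real ?N - real c)"
      using N p by (simp add: of_nat_diff field_simps)
    also have "\<dots> \<le> 1 - real c / ?N" using p by (simp add: frac_le)
    also have "\<dots> \<le> exp (- (real c / ?N))" using exp_ge_add_one_self[of "- (real c / ?N)"] by simp
    finally show "real (?N - 2 * c) / real (?N - c) \<le> exp (- (real c / ?N))" .
  qed simp
  also have "\<dots> = exp (- (real c ^ 2 / ?N))"
    by (simp add: exp_of_nat_mult[symmetric] power2_eq_square)
  finally show ?thesis .
qed

section \<open>Twisted hypercubes\<close>

definition bitstrings :: "nat \<Rightarrow> bool list set" where
  "bitstrings n = {xs. length xs = n}"

lemma finite_bitstrings: "finite (bitstrings n)"
  using finite_lists_length_eq[of "UNIV :: bool set" n] by (simp add: bitstrings_def)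

lemma card_bitstrings: "card (bitstrings n) = 2 ^ n"
  using card_lists_length_eq[of "UNIV :: bool set" n] by (simp add: bitstrings_def)

lemma bitstrings_Suc: "bitstrings (Suc n) = Cons False ` bitstrings n \<union> Cons True ` bitstrings n"
  unfolding bitstrings_def
proof safe
  fix xs :: "bool list" assume xs: "length xs = Suc n" "xs \<notin> Cons True ` {xs. length xs = n}"
  then obtain b ys where "xs = b # ys" "length ys = n" by (cases xs) auto
  with xs show "xs \<in> Cons False ` {xs. length xs = n}" by (cases b) auto
qed auto

section \<open>Matchings between the two halves as permutations of their common label set\<close>

definition cross_edges :: "bool list set \<Rightarrow> (bool list \<Rightarrow> bool list) \<Rightarrow> bool list set set" where
  "cross_edges V \<sigma> = (\<lambda>x. {False # x, True # \<sigma> x}) ` V"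

text \<open>Unique partners of the vertices \<open>False # x\<close> define a map
  \<open>\<sigma>\<close>. Unique partners of the vertices \<open>True # y\<close> make it
  bijective.\<close>

lemma perfect_matchings_eq_cross_edges:
  "perfect_matchings (Cons False ` V) (Cons True ` V) = cross_edges V ` {\<sigma>. \<sigma> permutes V}"
proof (intro equalityI subsetI)
  fix M assume "M \<in> perfect_matchings (Cons False ` V) (Cons True ` V)"
  then have M: "M \<subseteq> {{a, b} |a b. a \<in> Cons False ` V \<and> b \<in> Cons True ` V}"
    and uni: "\<And>v. v \<in> Cons False ` V \<union> Cons True ` V \<Longrightarrow> \<exists>!e. e \<in> M \<and> v \<in> e"
    unfolding perfect_matchings_def by blast+
  have sub: "\<exists>x\<in>V. \<exists>y\<in>V. e = {False # x, True # y}" if "e \<in> M" for e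
    using M that by blast
  have same: "e = e'" if "v \<in> Cons False ` V \<union> Cons True ` V" "e \<in> M" "v \<in> e" "e' \<in> M" "v \<in> e'" for v e e'
    using uni[OF that(1)] that(2-) by metis
  have ex: "\<exists>y\<in>V. {False # x, True # y} \<in> M" if "x \<in> V" for x
  proof -
    have "False # x \<in> Cons False ` V \<union> Cons True ` V" using that by simp
    from ex1_implies_ex[OF uni[OF this]] obtain e where e: "e \<in> M" "False # x \<in> e" by auto
    then obtain x' y' where "x' \<in> V" "y' \<in> V" "e = {False # x', True # y'}" using sub by metis
    with e show ?thesis by auto
  qed
  have ex': "\<exists>x\<in>V. {False # x, True # y} \<in> M" if "y \<in> V" for y
  proof -
    have "True # y \<in> Cons False ` V \<union> Cons True ` V" using that by simp
    from ex1_implies_ex[OF uni[OF this]] obtain e where e: "e \<in> M" "True # y \<in> e" by auto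
    then obtain x' y' where "x' \<in> V" "y' \<in> V" "e = {False # x', True # y'}" using sub by metis
    with e show ?thesis by auto
  qed
  have unique: "y = y'" if "x \<in> V" "{False # x, True # y} \<in> M" "{False # x, True # y'} \<in> M" for x y y'
  proof -
    have "False # x \<in> Cons False ` V \<union> Cons True ` V" using that by simp
    from same[OF this that(2) _ that(3)] have "{False # x, True # y} = {False # x, True # y'}" by simp
    then show ?thesis by (auto simp: doubleton_eq_iff)
  qed
  have unique': "x = x'" if "y \<in> V" "{False # x, True # y} \<in> M" "{False # x', True # y} \<in> M" for x x' y
  proof -
    have "True # y \<in> Cons False ` V \<union> Cons True ` V" using that by simp
    from same[OF this that(2) _ that(3)] have "{False # x, True # y} = {False # x', True # y}" by simp
    then show ?thesis by (auto simp: doubleton_eq_iff)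
  qed
  \<comment> \<open>Outside \<open>V\<close> the map is the identity, as \<open>permutes\<close>
    demands.\<close>
  define \<sigma> where "\<sigma> x = (if x \<in> V then THE y. y \<in> V \<and> {False # x, True # y} \<in> M else x)" for x
  have \<sigma>: "\<sigma> x \<in> V \<and> {False # x, True # \<sigma> x} \<in> M" if "x \<in> V" for x
  proof -
    have "\<exists>!y. y \<in> V \<and> {False # x, True # y} \<in> M" using ex[OF that] unique[OF that] by blast
    from theI'[OF this] show ?thesis using that by (simp add: \<sigma>_def)
  qed
  have "bij_betw \<sigma> V V"
    unfolding bij_betw_def inj_on_def
  proof (intro conjI ballI impI equalityI subsetI)
    fix x y assume "x \<in> V" "y \<in> V" "\<sigma> x = \<sigma> y"
    then show "x = y" using \<sigma>[of x] \<sigma>[of y] unique'[of "\<sigma> x" x y] by simp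
  next
    fix y assume "y \<in> V"
    then obtain x where x: "x \<in> V" "{False # x, True # y} \<in> M" using ex' by blast
    then have "y = \<sigma> x" using unique[of x y "\<sigma> x"] \<sigma>[of x] by blast
    then show "y \<in> \<sigma> ` V" using x by blast
  qed (use \<sigma> in auto)
  then have "\<sigma> permutes V" by (intro bij_imp_permutes) (auto simp: \<sigma>_def)
  moreover have "M = cross_edges V \<sigma>"
  proof (intro equalityI subsetI)
    fix e assume "e \<in> M"
    then obtain x y where "x \<in> V" "y \<in> V" "e = {False # x, True # y}" using sub by blast
    then show "e \<in> cross_edges V \<sigma>"
      using \<open>e \<in> M\<close> \<sigma>[of x] unique[of x y "\<sigma> x"] by (auto simp: cross_edges_def)
  qed (use \<sigma> in \<open>auto simp: cross_edges_def\<close>)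
  ultimately show "M \<in> cross_edges V ` {\<sigma>. \<sigma> permutes V}" by blast
next
  fix M assume "M \<in> cross_edges V ` {\<sigma>. \<sigma> permutes V}"
  then obtain \<sigma> where s: "\<sigma> permutes V" and M: "M = cross_edges V \<sigma>" by blast
  have "\<exists>!e. e \<in> M \<and> v \<in> e" if "v \<in> Cons False ` V \<union> Cons True ` V" for v
    using that
  proof
    assume "v \<in> Cons False ` V"
    then obtain x where "x \<in> V" "v = False # x" by blast
    then show ?thesis by (intro ex1I[of _ "{False # x, True # \<sigma> x}"]) (auto simp: M cross_edges_def)
  next
    assume "v \<in> Cons True ` V"
    then obtain y where y: "y \<in> V" "v = True # y" by blast
    then obtain x where "x \<in> V" "\<sigma> x = y" using s by (metis image_iff permutes_image)
    with y show ?thesis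
      using permutes_inj[OF s]
      by (intro ex1I[of _ "{False # x, True # \<sigma> x}"]) (auto simp: M cross_edges_def inj_eq)
  qed
  moreover have "M \<subseteq> {{a, b} |a b. a \<in> Cons False ` V \<and> b \<in> Cons True ` V}"
    using permutes_in_image[OF s] by (auto simp: M cross_edges_def)
  ultimately show "M \<in> perfect_matchings (Cons False ` V) (Cons True ` V)"
    unfolding perfect_matchings_def by blast
qed

text \<open>With injectivity, a uniform permutation induces a uniform perfect matching.\<close>

lemma inj_on_cross_edges: "inj_on (cross_edges V) {\<sigma>. \<sigma> permutes V}"
proof (rule inj_onI, rule ext)
  fix \<sigma> \<tau> x assume st: "\<sigma> \<in> {\<sigma>. \<sigma> permutes V}" "\<tau> \<in> {\<sigma>. \<sigma> permutes V}" "cross_edges V \<sigma> = cross_edges V \<tau>"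
  show "\<sigma> x = \<tau> x"
  proof (cases "x \<in> V")
    case True
    then have "{False # x, True # \<sigma> x} \<in> cross_edges V \<tau>" using st(3) by (auto simp: cross_edges_def)
    then obtain y where "{False # x, True # \<sigma> x} = {False # y, True # \<tau> y}"
      unfolding cross_edges_def by (rule imageE)
    then show ?thesis by (auto simp: doubleton_eq_iff)
  next
    case False
    then show ?thesis using st(1,2) permutes_not_in[of \<sigma> V x] permutes_not_in[of \<tau> V x] by simp
  qed
qed

definition twist :: "bool list ugraph \<Rightarrow> bool list ugraph \<Rightarrow> (bool list \<Rightarrow> bool list) \<Rightarrow> bool list ugraph" where
  "twist G0 G1 \<sigma> = join_graphs (map_graph (Cons False) G0) (map_graph (Cons True) G1) (cross_edges (verts G0) \<sigma>)"

text \<open>All pairs in the support share the vertex set \<open>V\<close>, so the law of the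
  permutation is the same whichever pair was drawn.\<close>

lemma twisted_step_eq:
  assumes "\<And>G0 G1. (G0, G1) \<in> set_pmf Q \<Longrightarrow> verts G0 = V \<and> verts G1 = V" and "finite V"
  shows "twisted_step Q = bind_pmf Q (\<lambda>(G0, G1). map_pmf (twist G0 G1) (pmf_of_set {\<sigma>. \<sigma> permutes V}))"
  unfolding twisted_step_def
proof (intro bind_pmf_cong refl, clarsimp simp: Let_def)
  fix G0 G1 assume "(G0, G1) \<in> set_pmf Q"
  then have v: "verts G0 = V" "verts G1 = V" using assms(1) by auto
  have ne: "{\<sigma>. \<sigma> permutes V} \<noteq> {}" using permutes_id by blast
  have "pmf_of_set (perfect_matchings (verts (map_graph (Cons False) G0)) (verts (map_graph (Cons True) G1)))
    = map_pmf (cross_edges V) (pmf_of_set {\<sigma>. \<sigma> permutes V})"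
    using perfect_matchings_eq_cross_edges[of V] inj_on_cross_edges finite_permutations[OF assms(2)] ne
    by (subst map_pmf_of_set_inj) (simp_all add: map_graph_def verts_def v[unfolded verts_def])
  then show "map_pmf (join_graphs (map_graph (Cons False) G0) (map_graph (Cons True) G1))
      (pmf_of_set (perfect_matchings (verts (map_graph (Cons False) G0)) (verts (map_graph (Cons True) G1)))) =
    map_pmf (twist G0 G1) (pmf_of_set {\<sigma>. \<sigma> permutes V})"
    by (simp add: map_pmf_comp twist_def[abs_def] v)
qed

text \<open>The two halves and the two directions of the matching are treated alike by indexing them with
  the leading bit.\<close>

definition half :: "bool list ugraph \<Rightarrow> bool list ugraph \<Rightarrow> bool \<Rightarrow> bool list ugraph" where
  "half G0 G1 b = (if b then G1 else G0)"

definition toward :: "(bool list \<Rightarrow> bool list) \<Rightarrow> bool \<Rightarrow> bool list \<Rightarrow> bool list" where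
  "toward \<sigma> b = (if b then inv \<sigma> else \<sigma>)"

text \<open>The deterministic counterpart of the random model, admitting every choice of halves and
  matchings. Whatever is proved for it holds surely.\<close>

inductive twisted_cube :: "nat \<Rightarrow> bool list ugraph \<Rightarrow> bool" where
  base: "twisted_cube 1 K2"
| step: "twisted_cube m G0 \<Longrightarrow> twisted_cube m G1 \<Longrightarrow> \<sigma> permutes bitstrings m \<Longrightarrow>
    twisted_cube (Suc m) (twist G0 G1 \<sigma>)"

section \<open>Vertices, edges and degrees after one step\<close>

lemma verts_twist: "verts (twist G0 G1 \<sigma>) = Cons False ` verts G0 \<union> Cons True ` verts G1"
  by (simp add: twist_def join_graphs_def map_graph_def verts_def)

lemma verts_twistE:
  assumes "v \<in> verts (twist G0 G1 \<sigma>)"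
  obtains b x where "v = b # x" "x \<in> verts (half G0 G1 b)"
  using assms that[of False] that[of True] unfolding verts_twist half_def by auto

lemma edges_twist:
  "edges (twist G0 G1 \<sigma>) = (`) (Cons False) ` edges G0 \<union> (`) (Cons True) ` edges G1 \<union> cross_edges (verts G0) \<sigma>"
  by (simp add: twist_def join_graphs_def map_graph_def edges_def)

lemma verts_twisted_cube: "twisted_cube m G \<Longrightarrow> verts G = bitstrings m"
proof (induction rule: twisted_cube.induct)
  case base
  show ?case by (auto simp: K2_def verts_def bitstrings_def length_Suc_conv)
qed (simp add: verts_twist bitstrings_Suc)

lemma twist_edge_half: "{x, y} \<in> edges (half G0 G1 b) \<Longrightarrow> {b # x, b # y} \<in> edges (twist G0 G1 \<sigma>)"
  using imageI[of "{x, y}" "edges (half G0 G1 b)" "(`) (Cons b)"]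
  by (cases b) (auto simp: half_def edges_twist)

lemma twist_edge_cross:
  assumes "\<sigma> permutes verts G0" "x \<in> verts G0"
  shows "{b # x, (\<not> b) # toward \<sigma> b x} \<in> edges (twist G0 G1 \<sigma>)"
proof -
  have "{b # x, (\<not> b) # toward \<sigma> b x} \<in> cross_edges (verts G0) \<sigma>"
    unfolding cross_edges_def
  \<comment> \<open>\<open>cross_edges\<close> indexes an edge by its endpoint in the
    \<open>False\<close> half, which is \<open>inv \<sigma> x\<close> when the given vertex lies in
    the \<open>True\<close> half.\<close>
  proof (rule rev_image_eqI[of "if b then inv \<sigma> x else x"])
    show "(if b then inv \<sigma> x else x) \<in> verts G0"
      using assms permutes_in_image[OF permutes_inv[OF assms(1)]] by simp
  qed (use permutes_inverses(1)[OF assms(1)] in \<open>auto simp: toward_def\<close>)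
  then show ?thesis by (simp add: edges_twist)
qed

text \<open>Converse of the two preceding edge lemmas, for the degree bound. Prepending a bit is
  injective, so an edge inside a half determines the original edge.\<close>

lemma twist_edgeD:
  assumes "{b # x, w} \<in> edges (twist G0 G1 \<sigma>)" "\<sigma> permutes verts G0"
  shows "(\<exists>y. w = b # y \<and> {x, y} \<in> edges (half G0 G1 b)) \<or> w = (\<not> b) # toward \<sigma> b x"
proof -
  have inv: "inv \<sigma> (\<sigma> y) = y" for y using permutes_inverses(2)[OF assms(2)] .
  have img: "\<exists>y. w = c # y \<and> {x, y} \<in> E \<and> c = b" if "{b # x, w} \<in> (`) (Cons c) ` E" for c E
  proof -
    from that obtain e where e: "{b # x, w} = Cons c ` e" "e \<in> E" by (rule imageE)
    then have "w \<in> Cons c ` e" "b # x \<in> Cons c ` e" by blast+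
    then obtain y where y: "w = c # y" "c = b" by auto
    then have "Cons c ` {x, y} = Cons c ` e" using e by simp
    then have "{x, y} = e" by (subst (asm) inj_image_eq_iff) (auto simp: inj_def)
    then show ?thesis using e y by auto
  qed
  show ?thesis
    using assms(1) img[of False "edges G0"] img[of True "edges G1"] inv
    unfolding edges_twist cross_edges_def half_def toward_def
    by (auto simp: doubleton_eq_iff)
qed

lemma twisted_cube_edges: "twisted_cube m G \<Longrightarrow> \<Union> (edges G) \<subseteq> verts G"
proof (induction rule: twisted_cube.induct)
  case base
  show ?case by (simp add: K2_def verts_def edges_def)
next
  case (step m G0 G1 \<sigma>)
  then show ?case
    by (auto simp: verts_twist edges_twist cross_edges_def verts_twisted_cube permutes_in_image)
qed

text \<open>Each step adds a single neighbour, the partner under the new matching.\<close>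

lemma twisted_cube_degree:
  assumes "twisted_cube m G" "v \<in> verts G"
  shows "card {w. {v, w} \<in> edges G} \<le> m"
  using assms
proof (induction arbitrary: v rule: twisted_cube.induct)
  case base
  then have "{w. {v, w} \<in> edges K2} = {if v = [True] then [False] else [True]}"
    by (auto simp: K2_def verts_def edges_def doubleton_eq_iff)
  then show ?case by simp
next
  case (step m G0 G1 \<sigma>)
  note v0 = verts_twisted_cube[OF step.hyps(1)] verts_twisted_cube[OF step.hyps(2)]
  obtain b x where v: "v = b # x" "x \<in> verts (half G0 G1 b)"
    using step.prems by (rule verts_twistE)
  let ?N = "{y. {x, y} \<in> edges (half G0 G1 b)}"
  have "\<Union> (edges (half G0 G1 b)) \<subseteq> bitstrings m"
    using twisted_cube_edges[OF step.hyps(1)] twisted_cube_edges[OF step.hyps(2)] v0 by (simp add: half_def)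
  then have fin: "finite ?N" by (intro finite_subset[OF _ finite_bitstrings[of m]]) auto
  have "{w. {v, w} \<in> edges (twist G0 G1 \<sigma>)} \<subseteq> insert ((\<not> b) # toward \<sigma> b x) (Cons b ` ?N)"
    using twist_edgeD[of b x _ G0 G1 \<sigma>] step.hyps(3) by (auto simp: v v0)
  then have "card {w. {v, w} \<in> edges (twist G0 G1 \<sigma>)} \<le> card (insert ((\<not> b) # toward \<sigma> b x) (Cons b ` ?N))"
    using fin by (intro card_mono) auto
  also have "\<dots> \<le> Suc (card (Cons b ` ?N))" using fin by (simp add: card_insert_if)
  also have "card (Cons b ` ?N) \<le> card ?N" using fin by (rule card_image_le)
  also have "card ?N \<le> m" using step.IH v by (auto simp: half_def split: if_splits)
  finally show ?case by simp
qed

lemma card_graph_ball_twisted_cube_le: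
  "twisted_cube m G \<Longrightarrow> v \<in> verts G \<Longrightarrow> card (graph_ball G v r) \<le> (m + 1) ^ r"
  by (intro card_graph_ball_le twisted_cube_edges twisted_cube_degree)
    (auto simp: verts_twisted_cube finite_bitstrings)

section \<open>Balls after one step\<close>

lemma graph_ball_twist_half: "y \<in> graph_ball (half G0 G1 b) x r \<Longrightarrow> b # y \<in> graph_ball (twist G0 G1 \<sigma>) (b # x) r"
proof (induction r arbitrary: y)
  case (Suc r)
  then obtain z where "z \<in> graph_ball (half G0 G1 b) x r" "y = z \<or> {z, y} \<in> edges (half G0 G1 b)" by auto
  then show ?case
    using Suc.IH[of z] twist_edge_half[of z y G0 G1 b \<sigma>] by (auto intro!: bexI[of _ "b # z"])
qed simp

text \<open>Walk in the own half, cross the top matching, walk on in the other half; the crossing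
  accounts for the 1. Both ball growth and the diameter bound rest on this.\<close>

lemma graph_ball_twist_cross:
  assumes "\<sigma> permutes verts G0" "verts G1 = verts G0"
    and "y \<in> verts G0" "y \<in> graph_ball (half G0 G1 b) x r"
    and "z \<in> graph_ball (half G0 G1 (\<not> b)) (toward \<sigma> b y) s"
  shows "(\<not> b) # z \<in> graph_ball (twist G0 G1 \<sigma>) (b # x) (r + s + 1)"
proof -
  let ?G = "twist G0 G1 \<sigma>"
  have "(\<not> b) # toward \<sigma> b y \<in> graph_ball ?G (b # x) (r + 1)"
    using graph_ball_trans[OF graph_ball_twist_half[OF assms(4)] graph_ball_1[OF twist_edge_cross[OF assms(1,3)]]] .
  from graph_ball_trans[OF this graph_ball_twist_half[OF assms(5)]]
  show ?thesis by (simp add: add_ac)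
qed

lemma finite_graph_ball_twisted_cube: "twisted_cube m G \<Longrightarrow> v \<in> verts G \<Longrightarrow> finite (graph_ball G v r)"
  using graph_ball_subset_verts[OF twisted_cube_edges] verts_twisted_cube finite_bitstrings finite_subset by metis

text \<open>A walk whose levels increase is determined by its end: the highest level is where the end
  leaves the half of the start, and the last matching edge can be undone.\<close>

lemma card_graph_ball_twisted_cube_ge:
  assumes "twisted_cube m G" "v \<in> verts G"
  shows "m choose r \<le> card (graph_ball G v r)"
  using assms
proof (induction arbitrary: v r rule: twisted_cube.induct)
  case (base v r)
  have fin: "finite (graph_ball K2 v r)"
    using finite_graph_ball_twisted_cube[OF twisted_cube.base base] .
  then have "0 < card (graph_ball K2 v r)"
    using graph_ball_centre[of v K2 r] by (metis card_gt_0_iff empty_iff)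
  moreover have "1 choose r \<le> (1 :: nat)" by (cases r; cases "r - 1") auto
  ultimately show ?case by linarith
next
  case (step m G0 G1 \<sigma>)
  note v0 = verts_twisted_cube[OF step.hyps(1)] verts_twisted_cube[OF step.hyps(2)]
  have cube: "twisted_cube (Suc m) (twist G0 G1 \<sigma>)" using step.hyps by (rule twisted_cube.step)
  obtain b x where v: "v = b # x" "x \<in> verts (half G0 G1 b)"
    using step.prems by (rule verts_twistE)
  have half: "twisted_cube m (half G0 G1 b)" using step.hyps by (simp add: half_def)
  have IH: "m choose s \<le> card (graph_ball (half G0 G1 b) x s)" for s
    using step.IH v by (auto simp: half_def split: if_splits)
  have sub: "graph_ball (half G0 G1 b) x s \<subseteq> verts G0" for s
    using graph_ball_subset_verts[OF twisted_cube_edges[OF half] v(2), of s] verts_twisted_cube[OF half]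
    by (simp add: v0)
  have fin: "finite (graph_ball (half G0 G1 b) x s)" for s
    by (rule finite_subset[OF sub]) (simp add: v0 finite_bitstrings)
  show ?case
  proof (cases r)
    case (Suc s)
    \<comment> \<open>Pascal's rule: \<open>?A\<close> stays in the own half with radius
      \<open>Suc s\<close>, \<open>?B\<close> uses radius \<open>s\<close> there and then crosses.
      The leading bit separates the two sets.\<close>
    let ?A = "Cons b ` graph_ball (half G0 G1 b) x (Suc s)"
    let ?B = "(\<lambda>y. (\<not> b) # toward \<sigma> b y) ` graph_ball (half G0 G1 b) x s"
    have inj: "inj (toward \<sigma> b)"
      using permutes_inj[OF step.hyps(3)] permutes_inj[OF permutes_inv[OF step.hyps(3)]] by (simp add: toward_def)
    have "?A \<subseteq> graph_ball (twist G0 G1 \<sigma>) v (Suc s)"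
      using graph_ball_twist_half v(1) by blast
    moreover have "?B \<subseteq> graph_ball (twist G0 G1 \<sigma>) v (Suc s)"
    proof clarify
      fix y assume y: "y \<in> graph_ball (half G0 G1 b) x s"
      show "(\<not> b) # toward \<sigma> b y \<in> graph_ball (twist G0 G1 \<sigma>) v (Suc s)"
        using graph_ball_twist_cross[of \<sigma> G0 G1 y b x s "toward \<sigma> b y" 0, OF _ _ _ y graph_ball_centre]
          step.hyps(3) sub[of s] y
        by (auto simp: v(1) v0 simp del: graph_ball.simps)
    qed
    ultimately have "card (?A \<union> ?B) \<le> card (graph_ball (twist G0 G1 \<sigma>) v (Suc s))"
      using finite_graph_ball_twisted_cube[OF cube step.prems] by (intro card_mono Un_least)
    moreover have "card (?A \<union> ?B) = card ?A + card ?B"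
      using fin by (intro card_Un_disjoint) (auto simp del: graph_ball.simps)
    moreover have "card ?A = card (graph_ball (half G0 G1 b) x (Suc s))" by (simp add: card_image del: graph_ball.simps)
    moreover have "card ?B = card (graph_ball (half G0 G1 b) x s)"
      using inj by (intro card_image) (auto simp: inj_on_def)
    ultimately show ?thesis using Suc IH[of s] IH[of "Suc s"] by (simp del: graph_ball.simps)
  qed simp
qed

section \<open>Ball growth and diameter under the random matching\<close>

lemma set_pmf_permutations: "finite V \<Longrightarrow> set_pmf (pmf_of_set {\<sigma>. \<sigma> permutes V}) = {\<sigma>. \<sigma> permutes V}"
  using permutes_id by (intro set_pmf_of_set finite_permutations) blast

text \<open>First-stage outcomes in \<open>B\<close> are charged in full, all others at most
  \<open>q\<close>.\<close>

lemma prob_bind_pmf_le: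
  assumes "\<And>x. x \<in> set_pmf Q \<Longrightarrow> x \<notin> B \<Longrightarrow> measure_pmf.prob (f x) A \<le> q" and "0 \<le> q"
  shows "measure_pmf.prob (bind_pmf Q f) A \<le> measure_pmf.prob Q B + q"
proof -
  have "emeasure (measure_pmf (bind_pmf Q f)) A = (\<integral>\<^sup>+x. emeasure (measure_pmf (f x)) A \<partial>Q)" by simp
  also have "\<dots> \<le> (\<integral>\<^sup>+x. indicator B x + ennreal q \<partial>Q)"
  proof (intro nn_integral_mono_AE, unfold AE_measure_pmf_iff, intro ballI)
    fix x assume x: "x \<in> set_pmf Q"
    show "emeasure (measure_pmf (f x)) A \<le> indicator B x + ennreal q"
    proof (cases "x \<in> B")
      case True
      then show ?thesis using measure_pmf.emeasure_le_1[of "f x" A] by (auto intro: order_trans)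
    next
      case False
      then show ?thesis
        using assms x by (simp add: measure_pmf.emeasure_eq_measure ennreal_leI)
    qed
  qed
  also have "\<dots> = emeasure (measure_pmf Q) B + ennreal q"
    by (subst nn_integral_add) auto
  also have "\<dots> = ennreal (measure_pmf.prob Q B + q)"
    using assms(2) by (simp add: measure_pmf.emeasure_eq_measure)
  finally show ?thesis using assms(2) by (simp add: measure_pmf.emeasure_eq_measure del: ennreal_plus)
qed

text \<open>The coupling enters through its marginals alone: a union bound over the two halves gives
  the factor 2 whatever their joint law.\<close>

lemma prob_twisted_step_le:
  assumes marg: "map_pmf fst Q = R" "map_pmf snd Q = R"
    and cube: "\<And>G. G \<in> set_pmf R \<Longrightarrow> twisted_cube m G"
    and good: "\<And>G0 G1. twisted_cube m G0 \<Longrightarrow> twisted_cube m G1 \<Longrightarrow> G0 \<notin> B \<Longrightarrow> G1 \<notin> B \<Longrightarrow>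
      measure_pmf.prob (pmf_of_set {\<sigma>. \<sigma> permutes bitstrings m}) {\<sigma>. twist G0 G1 \<sigma> \<in> A} \<le> q"
    and "0 \<le> q"
  shows "measure_pmf.prob (twisted_step Q) A \<le> 2 * measure_pmf.prob R B + q"
proof -
  have Q: "twisted_cube m G0 \<and> twisted_cube m G1" if "(G0, G1) \<in> set_pmf Q" for G0 G1
  proof -
    have "fst (G0, G1) \<in> set_pmf (map_pmf fst Q)" "snd (G0, G1) \<in> set_pmf (map_pmf snd Q)"
      using that unfolding set_map_pmf by blast+
    then show ?thesis using cube by (simp add: marg)
  qed
  let ?B = "fst -` B \<union> snd -` B"
  have "measure_pmf.prob (twisted_step Q) A \<le> measure_pmf.prob Q ?B + q"
  proof (subst twisted_step_eq[of Q "bitstrings m"])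
    show "verts G0 = bitstrings m \<and> verts G1 = bitstrings m" if "(G0, G1) \<in> set_pmf Q" for G0 G1
      using Q[OF that] verts_twisted_cube by blast
    show "measure_pmf.prob (bind_pmf Q (\<lambda>(G0, G1). map_pmf (twist G0 G1) (pmf_of_set {\<sigma>. \<sigma> permutes bitstrings m}))) A
      \<le> measure_pmf.prob Q ?B + q"
    proof (rule prob_bind_pmf_le[OF _ \<open>0 \<le> q\<close>])
      fix x assume x: "x \<in> set_pmf Q" "x \<notin> ?B"
      obtain G0 G1 where [simp]: "x = (G0, G1)" by (cases x)
      show "measure_pmf.prob (case x of (G0, G1) \<Rightarrow>
          map_pmf (twist G0 G1) (pmf_of_set {\<sigma>. \<sigma> permutes bitstrings m})) A \<le> q"
        using good[of G0 G1] Q[of G0 G1] x by (simp add: vimage_def)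
    qed
  qed (rule finite_bitstrings)
  also have "measure_pmf.prob Q ?B \<le> measure_pmf.prob Q (fst -` B) + measure_pmf.prob Q (snd -` B)"
    by (rule measure_Un_le) auto
  also have "\<dots> = 2 * measure_pmf.prob R B"
    using arg_cong[OF marg(1), of "\<lambda>p. measure_pmf.prob p B"] arg_cong[OF marg(2), of "\<lambda>p. measure_pmf.prob p B"]
    by simp
  finally show ?thesis by simp
qed

text \<open>This makes the degree and ball bounds available for every outcome of positive
  probability.\<close>

lemma random_twisted_hypercube_twisted_cube:
  assumes "random_twisted_hypercube P" "1 \<le> n" "G \<in> set_pmf (P n)"
  shows "twisted_cube n G"
  using assms(2,3)
proof (induction n arbitrary: G rule: nat_induct_at_least)
  case base
  then show ?case using assms(1) twisted_cube.base by (simp add: random_twisted_hypercube_def)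
next
  case (Suc n)
  then obtain Q where Q: "map_pmf fst Q = P n" "map_pmf snd Q = P n" "P (Suc n) = twisted_step Q"
    using assms(1) unfolding random_twisted_hypercube_def
    by (metis Suc_le_mono diff_Suc_1 numeral_2_eq_2 One_nat_def)
  have cubes: "twisted_cube n G0 \<and> twisted_cube n G1" if "(G0, G1) \<in> set_pmf Q" for G0 G1
  proof -
    have "fst (G0, G1) \<in> set_pmf (map_pmf fst Q)" "snd (G0, G1) \<in> set_pmf (map_pmf snd Q)"
      using that unfolding set_map_pmf by blast+
    then show ?thesis using Suc.IH by (simp add: Q)
  qed
  have "P (Suc n) = bind_pmf Q (\<lambda>(G0, G1). map_pmf (twist G0 G1) (pmf_of_set {\<sigma>. \<sigma> permutes bitstrings n}))"
    unfolding Q using cubes verts_twisted_cube by (intro twisted_step_eq finite_bitstrings) blast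
  then obtain G0 G1 \<sigma> where "(G0, G1) \<in> set_pmf Q" "\<sigma> permutes bitstrings n" "G = twist G0 G1 \<sigma>"
    using Suc.prems set_pmf_permutations[OF finite_bitstrings[of n]] by auto
  then show ?case using cubes twisted_cube.step by blast
qed

section \<open>One random matching: larger balls and small diameter\<close>

definition large_balls :: "'a ugraph \<Rightarrow> nat \<Rightarrow> nat \<Rightarrow> bool" where
  "large_balls G r b \<longleftrightarrow> (\<forall>v\<in>verts G. b \<le> card (graph_ball G v r))"

text \<open>The inverse of a uniform permutation is uniform, so both directions of the matching obey
  the same estimates.\<close>

lemma prob_toward:
  assumes "finite V"
  shows "measure_pmf.prob (pmf_of_set {\<sigma>. \<sigma> permutes V}) {\<sigma>. \<phi> (toward \<sigma> b)}
    = measure_pmf.prob (pmf_of_set {\<sigma>. \<sigma> permutes V}) {\<sigma>. \<phi> \<sigma>}"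
proof (cases b)
  case True
  have ne: "{\<sigma>. \<sigma> permutes V} \<noteq> {}" using permutes_id by blast
  have "bij_betw inv {\<sigma>. \<sigma> permutes V} {\<sigma>. \<sigma> permutes V}"
    unfolding bij_betw_def
  proof
    show "inj_on inv {\<sigma>. \<sigma> permutes V}"
      by (rule inj_on_inverseI[of _ inv]) (simp add: permutes_inv_inv)
    show "inv ` {\<sigma>. \<sigma> permutes V} = {\<sigma>. \<sigma> permutes V}"
      using image_inverse_permutations[of V] by (simp only: setcompr_eq_image)
  qed
  then have "map_pmf inv (pmf_of_set {\<sigma>. \<sigma> permutes V}) = pmf_of_set {\<sigma>. \<sigma> permutes V}"
    using ne finite_permutations[OF assms] by (rule map_pmf_of_set_bij_betw)
  from arg_cong[OF this, of "\<lambda>p. measure_pmf.prob p {\<sigma>. \<phi> \<sigma>}"] True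
  show ?thesis by (simp add: toward_def vimage_def)
qed (simp add: toward_def)

lemma obtain_distinct_list:
  assumes "k \<le> card S"
  obtains xs where "distinct xs" "length xs = k" "set xs \<subseteq> S"
proof -
  obtain T where T: "T \<subseteq> S" "card T = k" "finite T" using obtain_subset_with_card_n[OF assms] by blast
  obtain xs where "distinct xs" "set xs = T" using finite_distinct_list[OF T(3)] by blast
  with that T show ?thesis by (metis distinct_card)
qed

text \<open>\<open>prob_permutation_small_union\<close> is applied at each of the
  \<open>2 * 2 ^ m\<close> vertices, with \<open>B\<close> the balls of radius \<open>r\<close> in
  the opposite half. The new radius is \<open>s\<close> in the own half, one matching edge and
  \<open>r\<close> beyond it.\<close>

lemma prob_twist_large_balls:
  assumes cube: "twisted_cube m G0" "twisted_cube m G1"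
    and s: "large_balls G0 s (2 * c)" "large_balls G1 s (2 * c)"
    and r: "large_balls G0 r b" "large_balls G1 r b"
    and z: "256 * c * (m + 1) ^ (2 * r) \<le> 2 ^ m" and "c > 0"
  shows "measure_pmf.prob (pmf_of_set {\<sigma>. \<sigma> permutes bitstrings m})
      {\<sigma>. \<not> large_balls (twist G0 G1 \<sigma>) (s + r + 1) (c * b)} \<le> 2 * 2 ^ m * (1 / 8) ^ c"
proof -
  let ?V = "bitstrings m" and ?H = "half G0 G1"
  let ?p = "pmf_of_set {\<sigma>. \<sigma> permutes ?V}"
  have H: "twisted_cube m (?H h)" "large_balls (?H h) s (2 * c)" "large_balls (?H h) r b" for h
    using assms by (simp_all add: half_def)
  have vH: "verts (?H h) = ?V" for h using verts_twisted_cube[OF H(1)] .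
  have v0: "verts G0 = ?V" "verts G1 = ?V" using cube verts_twisted_cube by auto
  note balls = graph_ball_subset_verts[OF twisted_cube_edges[OF H(1)], unfolded vH]
    finite_graph_ball_twisted_cube[OF H(1), unfolded vH]
  \<comment> \<open>The list depends on the halves only and not on \<open>\<sigma>\<close>, so it is
    fixed before the permutation is drawn.\<close>
  define X where "X h x = (SOME xs. distinct xs \<and> length xs = 2 * c \<and> set xs \<subseteq> graph_ball (?H h) x s)" for h x
  have X: "distinct (X h x) \<and> length (X h x) = 2 * c \<and> set (X h x) \<subseteq> graph_ball (?H h) x s"
    if "x \<in> ?V" for h x
  proof -
    have "2 * c \<le> card (graph_ball (?H h) x s)" using H(2) that unfolding large_balls_def vH by blast
    then show ?thesis unfolding X_def by (rule obtain_distinct_list) (rule someI, blast)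
  qed
  define E where "E h x = {\<sigma>. card (\<Union>y\<in>set (X h x). graph_ball (?H (\<not> h)) (toward \<sigma> h y) r) < c * b}" for h x
  have E: "measure_pmf.prob ?p (E h x) \<le> (1 / 8) ^ c" if x: "x \<in> ?V" for h x
  proof -
    \<comment> \<open>Balls of radius \<open>r\<close> around \<open>u\<close> and \<open>w\<close>
      can meet only if \<open>w\<close> is within \<open>2 * r\<close> of \<open>u\<close>.\<close>
    have D: "card {w \<in> ?V. graph_ball (?H (\<not> h)) u r \<inter> graph_ball (?H (\<not> h)) w r \<noteq> {}} \<le> (m + 1) ^ (2 * r)"
      if "u \<in> ?V" for u
    proof -
      have "{w \<in> ?V. graph_ball (?H (\<not> h)) u r \<inter> graph_ball (?H (\<not> h)) w r \<noteq> {}} \<subseteq> graph_ball (?H (\<not> h)) u (r + r)"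
        using graph_ball_sym graph_ball_trans by fast
      then have "card {w \<in> ?V. graph_ball (?H (\<not> h)) u r \<inter> graph_ball (?H (\<not> h)) w r \<noteq> {}} \<le> card (graph_ball (?H (\<not> h)) u (2 * r))"
        using balls(2)[OF that] by (intro card_mono) (simp_all add: mult_2)
      also have "\<dots> \<le> (m + 1) ^ (2 * r)"
        using card_graph_ball_twisted_cube_le[OF H(1)] that vH by blast
      finally show ?thesis .
    qed
    have "measure_pmf.prob ?p (E h x) = measure_pmf.prob ?p {\<sigma>. card (\<Union>y\<in>set (X h x). graph_ball (?H (\<not> h)) (\<sigma> y) r) < c * b}"
      unfolding E_def by (rule prob_toward[OF finite_bitstrings])
    also have "\<dots> \<le> (1 / 8) ^ c"
    proof (rule prob_permutation_small_union[OF finite_bitstrings _ _ D])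
      show "b \<le> card (graph_ball (?H (\<not> h)) v r)" if "v \<in> ?V" for v
        using H(3) that by (simp add: large_balls_def vH)
      show "set (X h x) \<subseteq> ?V" using X[OF x] balls(1)[OF x] by blast
    qed (use balls(2) z \<open>c > 0\<close> X[OF x] in \<open>auto simp: card_bitstrings\<close>)
    finally show ?thesis .
  qed
  have "measure_pmf.prob ?p {\<sigma>. \<not> large_balls (twist G0 G1 \<sigma>) (s + r + 1) (c * b)}
    \<le> measure_pmf.prob ?p (\<Union>(h, x)\<in>UNIV \<times> ?V. E h x)"
  proof (rule measure_pmf_mono)
    fix \<sigma> assume "\<sigma> \<in> set_pmf ?p" and bad: "\<sigma> \<in> {\<sigma>. \<not> large_balls (twist G0 G1 \<sigma>) (s + r + 1) (c * b)}"
    then have \<sigma>: "\<sigma> permutes ?V"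
      by (simp add: set_pmf_permutations finite_bitstrings)
    let ?G = "twist G0 G1 \<sigma>"
    have cubeG: "twisted_cube (Suc m) ?G" using cube \<sigma> by (rule twisted_cube.step)
    obtain v where v: "v \<in> verts ?G" "card (graph_ball ?G v (s + r + 1)) < c * b"
      using bad by (auto simp: large_balls_def not_le)
    then obtain h x where hx: "v = h # x" "x \<in> verts (?H h)" by (elim verts_twistE)
    let ?U = "\<Union>y\<in>set (X h x). graph_ball (?H (\<not> h)) (toward \<sigma> h y) r"
    have "Cons (\<not> h) ` ?U \<subseteq> graph_ball ?G v (s + r + 1)"
    proof clarify
      fix y z assume yz: "y \<in> set (X h x)" "z \<in> graph_ball (?H (\<not> h)) (toward \<sigma> h y) r"
      have y: "y \<in> graph_ball (?H h) x s" "y \<in> ?V"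
        using X[of x h] hx(2) yz(1) balls(1) unfolding vH by blast+
      show "(\<not> h) # z \<in> graph_ball ?G v (s + r + 1)"
        unfolding hx(1) using graph_ball_twist_cross[OF _ _ _ y(1) yz(2)] \<sigma> v0 y(2) by simp
    qed
    then have "card (Cons (\<not> h) ` ?U) \<le> card (graph_ball ?G v (s + r + 1))"
      using finite_graph_ball_twisted_cube[OF cubeG v(1)] by (intro card_mono)
    moreover have "card (Cons (\<not> h) ` ?U) = card ?U" by (intro card_image) simp
    ultimately have "\<sigma> \<in> E h x" using v(2) unfolding E_def mem_Collect_eq by linarith
    then show "\<sigma> \<in> (\<Union>(h, x)\<in>UNIV \<times> ?V. E h x)" using hx(2) unfolding vH by blast
  qed
  also have "\<dots> \<le> (\<Sum>(h, x)\<in>UNIV \<times> ?V. measure_pmf.prob ?p (E h x))"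
    using measure_pmf.finite_measure_subadditive_finite[of "UNIV \<times> ?V" "\<lambda>(h, x). E h x" ?p] finite_bitstrings
    by (simp add: case_prod_unfold)
  also have "\<dots> \<le> (\<Sum>(h, x)\<in>(UNIV :: bool set) \<times> ?V. (1 / 8) ^ c)"
    by (intro sum_mono) (use E in auto)
  also have "\<dots> = 2 * 2 ^ m * (1 / 8) ^ c"
    by (simp add: case_prod_unfold card_cartesian_product card_bitstrings card_UNIV_bool)
  finally show ?thesis .
qed

text \<open>A union bound over pairs \<open>False # x\<close>, \<open>True # y\<close>: a matching
  edge between their balls gives distance at most \<open>2 * R + 1\<close>. Vertices of the same
  half pay one further step.\<close>

lemma prob_twist_diam:
  assumes cube: "twisted_cube m G0" "twisted_cube m G1"
    and R: "large_balls G0 R (2 * c)" "large_balls G1 R (2 * c)" and "c > 0"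
  shows "measure_pmf.prob (pmf_of_set {\<sigma>. \<sigma> permutes bitstrings m})
      {\<sigma>. \<not> diam (twist G0 G1 \<sigma>) \<le> enat (2 * R + 2)} \<le> 2 ^ m * 2 ^ m * exp (- (real c ^ 2 / 2 ^ m))"
proof -
  let ?V = "bitstrings m" let ?p = "pmf_of_set {\<sigma>. \<sigma> permutes ?V}"
  have v0: "verts G0 = ?V" "verts G1 = ?V" using cube verts_twisted_cube by auto
  note balls0 = graph_ball_subset_verts[OF twisted_cube_edges[OF cube(1)], unfolded v0]
  note balls1 = graph_ball_subset_verts[OF twisted_cube_edges[OF cube(2)], unfolded v0]
  have "\<exists>xs. distinct xs \<and> length xs = c \<and> set xs \<subseteq> graph_ball G0 x R" if "x \<in> ?V" for x
  proof -
    have "c \<le> card (graph_ball G0 x R)" using R(1) that unfolding large_balls_def v0 by fastforce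
    then show ?thesis by (metis obtain_distinct_list)
  qed
  then obtain X where X: "\<And>x. x \<in> ?V \<Longrightarrow> distinct (X x) \<and> length (X x) = c \<and> set (X x) \<subseteq> graph_ball G0 x R"
    by metis
  have "\<exists>T. card T = 2 * c \<and> T \<subseteq> graph_ball G1 y R" if "y \<in> ?V" for y
  proof -
    have "2 * c \<le> card (graph_ball G1 y R)" using R(2) that unfolding large_balls_def v0 by blast
    then show ?thesis by (metis obtain_subset_with_card_n)
  qed
  then obtain T where T: "\<And>y. y \<in> ?V \<Longrightarrow> card (T y) = 2 * c \<and> T y \<subseteq> graph_ball G1 y R" by metis
  define E where "E x y = {\<sigma>. \<sigma> ` set (X x) \<inter> T y = {}}" for x y
  have E: "measure_pmf.prob ?p (E x y) \<le> exp (- (real c ^ 2 / 2 ^ m))" if "x \<in> ?V" "y \<in> ?V" for x y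
  proof -
    have "set (X x) \<subseteq> ?V" "T y \<subseteq> ?V" using X T balls0 balls1 that by blast+
    then show ?thesis
      using prob_permutation_avoids[OF finite_bitstrings[of m], of "T y" c "X x"] X T that \<open>c > 0\<close>
      unfolding E_def by (simp add: card_bitstrings)
  qed
  have "measure_pmf.prob ?p {\<sigma>. \<not> diam (twist G0 G1 \<sigma>) \<le> enat (2 * R + 2)}
    \<le> measure_pmf.prob ?p (\<Union>(x, y)\<in>?V \<times> ?V. E x y)"
  proof (rule measure_pmf_mono, rule ccontr)
    fix \<sigma> assume "\<sigma> \<in> set_pmf ?p" and bad: "\<sigma> \<in> {\<sigma>. \<not> diam (twist G0 G1 \<sigma>) \<le> enat (2 * R + 2)}"
      and good: "\<sigma> \<notin> (\<Union>(x, y)\<in>?V \<times> ?V. E x y)"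
    then have \<sigma>: "\<sigma> permutes ?V"
      by (simp add: set_pmf_permutations finite_bitstrings)
    let ?G = "twist G0 G1 \<sigma>"
    have cubeG: "twisted_cube (Suc m) ?G" using cube \<sigma> by (rule twisted_cube.step)
    have opposite: "True # y \<in> graph_ball ?G (False # x) (2 * R + 1)" if xy: "x \<in> ?V" "y \<in> ?V" for x y
    proof -
      have "\<sigma> \<notin> E x y" using good xy by blast
      then obtain z where z: "z \<in> set (X x)" "\<sigma> z \<in> T y" unfolding E_def by blast
      have z1: "z \<in> graph_ball (half G0 G1 False) x R" "z \<in> ?V"
        using z(1) X[OF xy(1)] balls0[OF xy(1)] by (auto simp: half_def)
      have "\<sigma> z \<in> graph_ball G1 y R" using z(2) T[OF xy(2)] by blast
      then have z2: "y \<in> graph_ball (half G0 G1 (\<not> False)) (toward \<sigma> False z) R"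
        using graph_ball_sym by (simp add: half_def toward_def)
      show ?thesis
        using graph_ball_twist_cross[OF _ _ _ z1(1) z2] \<sigma> v0 z1(2) by (simp add: mult_2)
    qed
    \<comment> \<open>For a start in the \<open>True\<close> half, swap \<open>x\<close> and
      \<open>y\<close> and reverse the walk.\<close>
    have across: "(\<not> h) # y \<in> graph_ball ?G (h # x) (2 * R + 1)" if "x \<in> ?V" "y \<in> ?V" for h x y
      using opposite[of x y] graph_ball_sym[OF opposite[of y x]] that by (cases h) auto
    have "diam ?G \<le> enat (2 * R + 2)"
    proof (rule diam_le[OF twisted_cube_edges[OF cubeG]])
      fix u v assume "u \<in> verts ?G" "v \<in> verts ?G"
      then obtain h x k y where u: "u = h # x" "x \<in> ?V" and v: "v = k # y" "y \<in> ?V"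
        unfolding verts_twist v0 by blast
      show "v \<in> graph_ball ?G u (2 * R + 2)"
      proof (cases "k = h")
        case True
        \<comment> \<open>Moving to the matching partner first reduces to the opposite-half
          case.\<close>
        let ?u' = "toward \<sigma> h x"
        have "?u' \<in> ?V"
          using u(2) permutes_in_image[OF \<sigma>] permutes_in_image[OF permutes_inv[OF \<sigma>]] by (simp add: toward_def)
        then have "v \<in> graph_ball ?G ((\<not> h) # ?u') (2 * R + 1)"
          using across[of ?u' y "\<not> h"] True v by simp
        moreover have "(\<not> h) # ?u' \<in> graph_ball ?G u 1"
          unfolding u(1) using \<sigma> u(2) v0 by (intro graph_ball_1 twist_edge_cross) simp_all
        ultimately show ?thesis using graph_ball_trans[of "(\<not> h) # ?u'" ?G u 1 v "2 * R + 1"] by simp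
      next
        case False
        then have "v \<in> graph_ball ?G u (2 * R + 1)" using across[OF u(2) v(2), of h] u v by (cases h) auto
        then show ?thesis using graph_ball_mono[of "2 * R + 1" "2 * R + 2" ?G u] by auto
      qed
    qed
    then show False using bad by simp
  qed
  also have "\<dots> \<le> (\<Sum>(x, y)\<in>?V \<times> ?V. measure_pmf.prob ?p (E x y))"
    using measure_pmf.finite_measure_subadditive_finite[of "?V \<times> ?V" "\<lambda>(x, y). E x y" ?p] finite_bitstrings
    by (simp add: case_prod_unfold)
  also have "\<dots> \<le> (\<Sum>(x, y)\<in>?V \<times> ?V. exp (- (real c ^ 2 / 2 ^ m)))"
    by (intro sum_mono) (use E in auto)
  also have "\<dots> = 2 ^ m * 2 ^ m * exp (- (real c ^ 2 / 2 ^ m))"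
    by (simp add: case_prod_unfold card_cartesian_product card_bitstrings)
  finally show ?thesis .
qed

text \<open>With \<open>q = 2 ^ (m + J) * (1 / 8) ^ d\<close>, the failure probabilities satisfy
  \<open>p (j + 1) \<le> 2 * p j + q\<close> and \<open>p 0 = 0\<close>, which solves to
  \<open>(2 ^ j - 1) * q\<close>. The packing hypothesis is stated for \<open>J\<close> and covers
  all earlier steps.\<close>

lemma prob_not_large_balls:
  assumes P: "random_twisted_hypercube P" and "1 \<le> m" "1 \<le> d" "2 * d \<le> m choose r"
    and J: "256 * d ^ J * (m + J) ^ (2 * r) \<le> 2 ^ m" and "j \<le> J"
  shows "measure_pmf.prob (P (m + j)) {G. \<not> large_balls G (j * (r + 1) + r) (2 * d ^ (j + 1))}
    \<le> (2 ^ j - 1) * (2 ^ (m + J) * (1 / 8) ^ d)"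
  using \<open>j \<le> J\<close>
proof (induction j)
  case 0
  \<comment> \<open>The start is free of randomness: the binomial bound holds for every
    outcome.\<close>
  have "large_balls G r (2 * d)" if "G \<in> set_pmf (P m)" for G
    using card_graph_ball_twisted_cube_ge[OF random_twisted_hypercube_twisted_cube[OF P \<open>1 \<le> m\<close> that]] assms(4)
    unfolding large_balls_def by (meson order_trans)
  then have "measure_pmf.prob (P m) {G. \<not> large_balls G r (2 * d)} = 0"
    by (auto simp: measure_pmf_zero_iff)
  then show ?case by simp
next
  case (Suc j)
  let ?q = "2 ^ (m + J) * (1 / 8 :: real) ^ d"
  have "Suc (m + j) \<ge> 2" "Suc (m + j) - 1 = m + j" using \<open>1 \<le> m\<close> by auto
  then obtain Q where Q: "map_pmf fst Q = P (m + j)" "map_pmf snd Q = P (m + j)" "P (Suc (m + j)) = twisted_step Q"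
    using P unfolding random_twisted_hypercube_def by metis
  define c where "c = d ^ (j + 1)"
  have c: "d \<le> c" "c > 0" "c \<le> d ^ J"
    using \<open>1 \<le> d\<close> Suc.prems self_le_power[of d "j + 1"] unfolding c_def
    by (auto intro: power_increasing simp del: power_Suc)
  have "256 * c * (m + j + 1) ^ (2 * r) \<le> 256 * d ^ J * (m + J) ^ (2 * r)"
    using c(3) Suc.prems by (intro mult_le_mono power_mono) auto
  also have "\<dots> \<le> 2 ^ (m + j)" using order_trans[OF J power_increasing[of m "m + j" "2 :: nat"]] by simp
  finally have z: "256 * c * (m + j + 1) ^ (2 * r) \<le> 2 ^ (m + j)" .
  have r: "large_balls G r (2 * d)" if "twisted_cube (m + j) G" for G
    using card_graph_ball_twisted_cube_ge[OF that, of _ r] assms(4) binomial_right_mono[of m "m + j" r]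
    unfolding large_balls_def by fastforce
  have rad: "Suc j * (r + 1) + r = (j * (r + 1) + r) + r + 1" by simp
  \<comment> \<open>The step is used with \<open>c = d ^ (j + 1)\<close> and
    \<open>b = 2 * d\<close>, so the ball size gains a factor \<open>d\<close>.\<close>
  have size: "2 * d ^ (Suc j + 1) = c * (2 * d)" by (simp add: c_def)
  have "measure_pmf.prob (twisted_step Q) {G. \<not> large_balls G (Suc j * (r + 1) + r) (2 * d ^ (Suc j + 1))}
    \<le> 2 * measure_pmf.prob (P (m + j)) {G. \<not> large_balls G (j * (r + 1) + r) (2 * d ^ (j + 1))} + ?q"
  proof (rule prob_twisted_step_le[OF Q(1,2) random_twisted_hypercube_twisted_cube[OF P]])
    fix G0 G1
    assume cubes: "twisted_cube (m + j) G0" "twisted_cube (m + j) G1"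
      and "G0 \<notin> {G. \<not> large_balls G (j * (r + 1) + r) (2 * d ^ (j + 1))}"
        "G1 \<notin> {G. \<not> large_balls G (j * (r + 1) + r) (2 * d ^ (j + 1))}"
    then have good: "large_balls G0 (j * (r + 1) + r) (2 * c)" "large_balls G1 (j * (r + 1) + r) (2 * c)"
      by (simp_all only: c_def mem_Collect_eq not_not)
    have "measure_pmf.prob (pmf_of_set {\<sigma>. \<sigma> permutes bitstrings (m + j)})
      {\<sigma>. \<not> large_balls (twist G0 G1 \<sigma>) (Suc j * (r + 1) + r) (2 * d ^ (Suc j + 1))} \<le> 2 * 2 ^ (m + j) * (1 / 8) ^ c"
      unfolding rad size by (rule prob_twist_large_balls[OF cubes good r[OF cubes(1)] r[OF cubes(2)] z c(2)])
    also have "2 * 2 ^ (m + j) = (2 :: real) ^ (m + j + 1)" by simp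
    also have "(2 :: real) ^ (m + j + 1) * (1 / 8) ^ c \<le> ?q"
      using Suc.prems c(1) by (intro mult_mono power_increasing power_decreasing) auto
    finally show "measure_pmf.prob (pmf_of_set {\<sigma>. \<sigma> permutes bitstrings (m + j)})
      {\<sigma>. twist G0 G1 \<sigma> \<in> {G. \<not> large_balls G (Suc j * (r + 1) + r) (2 * d ^ (Suc j + 1))}} \<le> ?q"
      by (simp only: mem_Collect_eq)
  qed (use \<open>1 \<le> m\<close> in auto)
  also have "\<dots> \<le> 2 * ((2 ^ j - 1) * ?q) + ?q"
    using Suc.IH Suc.prems by (intro add_right_mono mult_left_mono) auto
  also have "\<dots> = (2 ^ Suc j - 1) * ?q" by (simp add: algebra_simps)
  finally show ?case by (simp only: Q(3)[symmetric] add_Suc_right)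
qed

text \<open>The dimension after the \<open>J\<close> growth steps supplies the last matching. Its
  two halves double the failure probability once more.\<close>

lemma prob_diam_gt:
  assumes P: "random_twisted_hypercube P" and "1 \<le> m" "1 \<le> d" "2 * d \<le> m choose r"
    and J: "256 * d ^ J * (m + J) ^ (2 * r) \<le> 2 ^ m"
  shows "measure_pmf.prob (P (m + J + 1)) {G. \<not> diam G \<le> enat (2 * (J + 1) * (r + 1))}
    \<le> 2 * ((2 ^ J - 1) * (2 ^ (m + J) * (1 / 8) ^ d))
      + 2 ^ (m + J) * 2 ^ (m + J) * exp (- (real (d ^ (J + 1)) ^ 2 / 2 ^ (m + J)))" (is "_ \<le> 2 * ?p + ?q")
proof -
  have "m + J + 1 \<ge> 2" "m + J + 1 - 1 = m + J" using \<open>1 \<le> m\<close> by auto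
  then obtain Q where Q: "map_pmf fst Q = P (m + J)" "map_pmf snd Q = P (m + J)" "P (m + J + 1) = twisted_step Q"
    using P unfolding random_twisted_hypercube_def by metis
  let ?R = "J * (r + 1) + r"
  have R: "2 * (J + 1) * (r + 1) = 2 * ?R + 2" by (simp add: algebra_simps)
  have "measure_pmf.prob (twisted_step Q) {G. \<not> diam G \<le> enat (2 * (J + 1) * (r + 1))}
    \<le> 2 * measure_pmf.prob (P (m + J)) {G. \<not> large_balls G ?R (2 * d ^ (J + 1))} + ?q"
  proof (rule prob_twisted_step_le[OF Q(1,2) random_twisted_hypercube_twisted_cube[OF P]])
    fix G0 G1
    assume cubes: "twisted_cube (m + J) G0" "twisted_cube (m + J) G1"
      and "G0 \<notin> {G. \<not> large_balls G ?R (2 * d ^ (J + 1))}" "G1 \<notin> {G. \<not> large_balls G ?R (2 * d ^ (J + 1))}"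
    then have good: "large_balls G0 ?R (2 * d ^ (J + 1))" "large_balls G1 ?R (2 * d ^ (J + 1))"
      by (simp_all only: mem_Collect_eq not_not)
    show "measure_pmf.prob (pmf_of_set {\<sigma>. \<sigma> permutes bitstrings (m + J)})
      {\<sigma>. twist G0 G1 \<sigma> \<in> {G. \<not> diam G \<le> enat (2 * (J + 1) * (r + 1))}} \<le> ?q"
      unfolding R mem_Collect_eq using \<open>1 \<le> d\<close> by (intro prob_twist_diam[OF cubes good]) simp
  qed (use \<open>1 \<le> m\<close> in auto)
  also have "\<dots> \<le> 2 * ?p + ?q"
    using prob_not_large_balls[OF assms order_refl] by simp
  finally show ?thesis by (simp only: Q(3))
qed

section \<open>Asymptotics\<close>

text \<open>A ball of radius \<open>D\<close> around any one vertex must cover all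
  \<open>2 ^ n\<close> vertices.\<close>

lemma twisted_cube_diam_ge:
  assumes "twisted_cube n G" "diam G = enat D"
  shows "2 ^ n \<le> (n + 1) ^ D"
proof -
  have v: "replicate n False \<in> verts G"
    using verts_twisted_cube[OF assms(1)] by (simp add: bitstrings_def)
  have "card (verts G) \<le> card (graph_ball G (replicate n False) D)"
    by (rule card_mono[OF finite_graph_ball_twisted_cube[OF assms(1) v] verts_subset_graph_ball_diam[OF assms(2) v]])
  also have "\<dots> \<le> (n + 1) ^ D" by (rule card_graph_ball_twisted_cube_le[OF assms(1) v])
  finally show ?thesis by (simp add: verts_twisted_cube[OF assms(1)] card_bitstrings)
qed

text \<open>With \<open>d = n ^ (r - 1)\<close>, about \<open>n / (2 * (r - 1) * log 2 n)\<close>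
  steps are taken, so the radius bound is near \<open>(r + 1) / (r - 1)\<close> times
  \<open>n / log 2 n\<close>. The hypothesis on \<open>r\<close> spends one half of
  \<open>\<epsilon>\<close> on this ratio, and additive constants use the other.\<close>

lemma eventually_parameters:
  fixes \<epsilon> :: real
  assumes "\<epsilon> > 0" "2 \<le> r" and r: "real r + 1 \<le> (1 + \<epsilon> / 2) * (real r - 1)"
  shows "\<forall>\<^sub>F n in sequentially. \<exists>J m. n = m + J + 1 \<and> 1 \<le> m \<and> 2 * n ^ (r - 1) \<le> m choose r \<and>
    256 * (n ^ (r - 1)) ^ J * (m + J) ^ (2 * r) \<le> 2 ^ m \<and>
    3 * n * 2 ^ (m + J) \<le> ((n ^ (r - 1)) ^ (J + 1)) ^ 2 \<and>
    real (2 * (J + 1) * (r + 1)) \<le> (1 + \<epsilon>) * (real n / log 2 (real n))"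
proof -
  define C where "C = 2 * real r + 1"
  \<comment> \<open>Chosen so that the additive constants of the final estimate sum to
    \<open>C' * (\<epsilon> / 2)\<close>.\<close>
  define C' where "C' = ((1 + \<epsilon> / 2) * 2 + 2 * (real r + 1)) / (\<epsilon> / 2)"
  have C: "C > 0" by (simp add: C_def)
  \<comment> \<open>The budget for packing: 256 costs 8 in the exponent, ball growth
    \<open>n / 2 + L\<close>, the factor \<open>n ^ (2 * r)\<close> another
    \<open>2 * r * L\<close>, and the dimensions used up at most \<open>x + 3\<close>. Here
    \<open>L = log 2 n\<close> and \<open>x = n / L\<close>.\<close>
  have e1: "\<forall>\<^sub>F n in sequentially. 11 + real n / 2 + C * log 2 (real n) + real n / log 2 (real n) \<le> real n"
    using C by real_asymp
  have "filterlim (\<lambda>n. real n / log 2 (real n)) at_top sequentially" by real_asymp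
  then have e2: "\<forall>\<^sub>F n in sequentially. C' \<le> real n / log 2 (real n)"
    by (simp add: filterlim_at_top)
  have e3: "\<forall>\<^sub>F n in sequentially. n \<ge> 2 * (2 * r) ^ r" by (rule eventually_ge_at_top)
  have e4: "\<forall>\<^sub>F n in sequentially. (n :: nat) \<ge> 2" by (rule eventually_ge_at_top)
  from e1 e2 e3 e4 show ?thesis
  proof eventually_elim
    case (elim n)
    define L where "L = log 2 (real n)"
    define x where "x = real n / L"
    have L: "1 \<le> L" using elim(4) by (simp add: L_def le_log_iff)
    have nL: "2 powr L = real n" using elim(4) by (simp add: L_def)
    have x: "x \<ge> 0" "x * L = real n" using L by (simp_all add: x_def)
    have n_pow: "real n ^ a = 2 powr (real a * L)" for a
      using nL by (simp add: powr_realpow[symmetric] powr_powr mult.commute flip: nL)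
    \<comment> \<open>The real number of steps with
      \<open>n ^ ((r - 1) * \<kappa>) = n * 2 ^ (n / 2)\<close>, the ball size that the last
      matching requires.\<close>
    define \<kappa> where "\<kappa> = (x + 2) / (2 * (real r - 1))"
    have r1: "real r - 1 \<ge> 1" using \<open>2 \<le> r\<close> by simp
    have \<kappa>: "\<kappa> > 0" "\<kappa> * (real r - 1) = (x + 2) / 2" "\<kappa> \<le> x + 2"
    proof -
      show "\<kappa> > 0" using x r1 by (simp add: \<kappa>_def)
      show k: "\<kappa> * (real r - 1) = (x + 2) / 2" using r1 by (simp add: \<kappa>_def field_simps)
      have "\<kappa> * 1 \<le> \<kappa> * (real r - 1)" using r1 \<open>\<kappa> > 0\<close> by (intro mult_left_mono) auto
      then show "\<kappa> \<le> x + 2" using k x by simp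
    qed
    define K where "K = nat \<lceil>\<kappa>\<rceil>"
    have K: "\<kappa> \<le> real K" "real K \<le> \<kappa> + 1" "K \<ge> 1" using \<kappa>(1) unfolding K_def by linarith+
    \<comment> \<open>Rounding helps twice: \<open>J \<le> \<kappa>\<close> serves the packing bound
      and \<open>\<kappa> \<le> J + 1\<close> the final ball size.\<close>
    define J where "J = K - 1"
    define m where "m = n - K"
    have Jr: "real J = real K - 1" using K(3) by (simp add: J_def)
    have budget: "11 + real n / 2 + C * L + x \<le> real n" using elim(1) by (simp add: L_def x_def)
    have CL: "C * L \<ge> C" using C L by simp
    have Kn: "real K \<le> real n / 2" using budget CL C K(2) \<kappa>(3) by linarith
    have "K \<le> n" using Kn by linarith
    then have mr: "real m = real n - real K" and n: "n = m + J + 1"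
      using K(3) by (simp_all add: m_def J_def)
    have m2: "real n / 2 \<le> real m" using Kn mr by linarith
    have "real r \<le> real m" using m2 budget CL x C_def by linarith
    then have rm: "r \<le> m" by simp
    have m1: "1 \<le> m" using rm \<open>2 \<le> r\<close> by simp
    have choose: "2 * n ^ (r - 1) \<le> m choose r"
    proof -
      \<comment> \<open>Since \<open>m\<close> is at least \<open>n / 2\<close>, the binomial is at
        least \<open>(n / (2 * r)) ^ r\<close>; one factor \<open>n\<close> pays for
        \<open>2 * (2 * r) ^ r\<close>.\<close>
      have "2 * real n ^ (r - 1) = 2 * (2 * real r) ^ r * (real n ^ (r - 1) / (2 * real r) ^ r)"
        using \<open>2 \<le> r\<close> by simp
      also have "\<dots> \<le> real n * (real n ^ (r - 1) / (2 * real r) ^ r)"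
      proof (rule mult_right_mono)
        have "real (2 * (2 * r) ^ r) \<le> real n" using elim(3) by (simp only: of_nat_le_iff)
        then show "2 * (2 * real r) ^ r \<le> real n" by simp
      qed simp
      also have "\<dots> = (real n / (2 * real r)) ^ r"
        using \<open>2 \<le> r\<close> by (cases r) (simp_all add: power_divide)
      also have "\<dots> \<le> (real m / real r) ^ r"
        using m2 \<open>2 \<le> r\<close> by (intro power_mono) (simp_all add: field_simps)
      also have "\<dots> \<le> real (m choose r)" by (rule binomial_ge_n_over_k_pow_k[OF rm])
      finally have "real (2 * n ^ (r - 1)) \<le> real (m choose r)" by simp
      then show ?thesis by (simp only: of_nat_le_iff)
    qed
    have pack: "256 * (n ^ (r - 1)) ^ J * (m + J) ^ (2 * r) \<le> 2 ^ m"
    proof -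
      have "real (256 * (n ^ (r - 1)) ^ J * (m + J) ^ (2 * r)) \<le> real (256 * (n ^ (r - 1)) ^ J * n ^ (2 * r))"
        using n by (intro of_nat_mono mult_le_mono power_mono) auto
      also have "\<dots> = 2 ^ 8 * real n ^ ((r - 1) * J) * real n ^ (2 * r)" by (simp add: power_mult)
      also have "\<dots> = 2 powr (8 + real ((r - 1) * J) * L + real (2 * r) * L)"
        unfolding n_pow by (simp add: powr_add)
      also have "\<dots> \<le> 2 powr (real m)"
      proof (rule powr_mono)
        have "real ((r - 1) * J) = (real r - 1) * real J" using \<open>2 \<le> r\<close> by (simp add: of_nat_diff)
        also have "\<dots> \<le> (real r - 1) * \<kappa>" using Jr K(2) r1 by (intro mult_left_mono) auto
        finally have "real ((r - 1) * J) \<le> (x + 2) / 2" using \<kappa>(2) by (simp add: mult.commute)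
        then have "real ((r - 1) * J) * L \<le> (x + 2) / 2 * L" using L by (intro mult_right_mono) auto
        also have "\<dots> = real n / 2 + L" using x(2) by (simp add: algebra_simps)
        finally have "real ((r - 1) * J) * L \<le> real n / 2 + L" .
        moreover have "C * L = L + real (2 * r) * L" by (simp add: C_def algebra_simps)
        ultimately show "8 + real ((r - 1) * J) * L + real (2 * r) * L \<le> real m"
          using budget K(2) \<kappa>(3) mr by linarith
      qed simp
      also have "\<dots> = real (2 ^ m)" by (simp add: powr_realpow)
      finally show ?thesis by (simp only: of_nat_le_iff)
    qed
    have hit: "3 * n * 2 ^ (m + J) \<le> ((n ^ (r - 1)) ^ (J + 1)) ^ 2"
    proof -
      have "3 * n \<le> 2 * n * n" using elim(4) by (intro mult_le_mono) auto
      then have "3 * n * 2 ^ (m + J) \<le> 2 * n * n * 2 ^ (m + J)" by (rule mult_le_mono1)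
      also have "\<dots> = 2 ^ (m + J + 1) * n ^ 2" by (simp add: power2_eq_square)
      finally have "3 * n * 2 ^ (m + J) \<le> 2 ^ n * n ^ 2" by (simp only: n[symmetric])
      then have "real (3 * n * 2 ^ (m + J)) \<le> real (2 ^ n * n ^ 2)" by (simp only: of_nat_le_iff)
      also have "\<dots> = 2 powr (real n + 2 * L)"
        using n_pow[of 2] by (simp add: powr_add powr_realpow)
      also have "\<dots> \<le> 2 powr (real ((r - 1) * K * 2) * L)"
      proof (rule powr_mono)
        have "x + 2 = (real r - 1) * \<kappa> * 2" using \<kappa>(2) by (simp add: mult.commute)
        also have "\<dots> \<le> (real r - 1) * real K * 2" using K(1) r1 by (intro mult_left_mono mult_right_mono) auto
        also have "\<dots> = real ((r - 1) * K * 2)" using \<open>2 \<le> r\<close> by (simp add: of_nat_diff)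
        finally have "(x + 2) * L \<le> real ((r - 1) * K * 2) * L" using L by (intro mult_right_mono) auto
        then show "real n + 2 * L \<le> real ((r - 1) * K * 2) * L" using x(2) by (simp add: distrib_right)
      qed simp
      also have "\<dots> = real (((n ^ (r - 1)) ^ (J + 1)) ^ 2)"
        using K(3) unfolding n_pow[symmetric] by (simp add: J_def power_mult)
      finally show ?thesis by (simp only: of_nat_le_iff)
    qed
    have "real (2 * (J + 1) * (r + 1)) = 2 * real K * (real r + 1)" using K(3) by (simp add: J_def algebra_simps)
    also have "\<dots> \<le> 2 * (\<kappa> + 1) * (real r + 1)" using K(2) by (intro mult_right_mono) auto
    also have "\<dots> = 2 * \<kappa> * (real r + 1) + 2 * (real r + 1)" by (simp add: algebra_simps)
    also have "2 * \<kappa> * (real r + 1) \<le> 2 * \<kappa> * ((1 + \<epsilon> / 2) * (real r - 1))"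
      using r \<kappa>(1) by (intro mult_left_mono) auto
    also have "\<dots> = (1 + \<epsilon> / 2) * 2 * (\<kappa> * (real r - 1))" by simp
    also have "\<dots> = (1 + \<epsilon> / 2) * (x + 2)" unfolding \<kappa>(2) by simp
    also have "(1 + \<epsilon> / 2) * (x + 2) + 2 * (real r + 1) \<le> (1 + \<epsilon>) * x"
    proof -
      have C': "C' * (\<epsilon> / 2) = (1 + \<epsilon> / 2) * 2 + 2 * (real r + 1)"
        unfolding C'_def using \<open>\<epsilon> > 0\<close> by simp
      have "(1 + \<epsilon> / 2) * (x + 2) + 2 * (real r + 1) = (1 + \<epsilon> / 2) * x + C' * (\<epsilon> / 2)"
        unfolding C' by (simp only: distrib_left add.assoc)
      also have "C' * (\<epsilon> / 2) \<le> x * (\<epsilon> / 2)"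
        using elim(2) \<open>\<epsilon> > 0\<close> by (intro mult_right_mono) (auto simp: x_def L_def)
      also have "(1 + \<epsilon> / 2) * x + x * (\<epsilon> / 2) = (1 + \<epsilon>) * x" by (simp add: algebra_simps)
      finally show ?thesis by simp
    qed
    finally have "real (2 * (J + 1) * (r + 1)) \<le> (1 + \<epsilon>) * (real n / log 2 (real n))"
      by (simp add: x_def L_def)
    with n m1 choose pack hit show ?case by blast
  qed
qed

lemma eventually_prob_diam_gt:
  fixes \<epsilon> :: real
  assumes P: "random_twisted_hypercube P" and "\<epsilon> > 0"
  shows "\<forall>\<^sub>F n in sequentially. \<exists>k. real k \<le> (1 + \<epsilon>) * (real n / log 2 (real n)) \<and>
    measure_pmf.prob (P n) {G. \<not> diam G \<le> enat k} \<le> 2 * (1 / 2) ^ n"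
proof -
  \<comment> \<open>From \<open>r - 1 \<ge> 4 / \<epsilon>\<close> the difference 2 between
    \<open>r + 1\<close> and \<open>r - 1\<close> is at most
    \<open>\<epsilon> / 2 * (r - 1)\<close>.\<close>
  define r where "r = nat \<lceil>4 / \<epsilon>\<rceil> + 2"
  have r: "2 \<le> r" "4 / \<epsilon> + 1 \<le> real r" unfolding r_def by linarith+
  have "2 \<le> \<epsilon> / 2 * (real r - 1)" using r(2) \<open>\<epsilon> > 0\<close> by (simp add: field_simps)
  then have r3: "real r + 1 \<le> (1 + \<epsilon> / 2) * (real r - 1)" by (simp add: algebra_simps)
  show ?thesis
    using eventually_parameters[OF \<open>\<epsilon> > 0\<close> r(1) r3] eventually_ge_at_top[of 2]
  proof eventually_elim
    case (elim n)
    then obtain J m where n: "n = m + J + 1" and "1 \<le> m" and choose: "2 * n ^ (r - 1) \<le> m choose r"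
      and pack: "256 * (n ^ (r - 1)) ^ J * (m + J) ^ (2 * r) \<le> 2 ^ m"
      and hit: "3 * n * 2 ^ (m + J) \<le> ((n ^ (r - 1)) ^ (J + 1)) ^ 2"
      and k: "real (2 * (J + 1) * (r + 1)) \<le> (1 + \<epsilon>) * (real n / log 2 (real n))"
      by blast
    let ?d = "n ^ (r - 1)"
    have d: "n \<le> ?d" using r(1) elim(2) by (intro self_le_power) auto
    have "measure_pmf.prob (P n) {G. \<not> diam G \<le> enat (2 * (J + 1) * (r + 1))}
      \<le> 2 * ((2 ^ J - 1) * (2 ^ (m + J) * (1 / 8) ^ ?d))
        + 2 ^ (m + J) * 2 ^ (m + J) * exp (- (real (?d ^ (J + 1)) ^ 2 / 2 ^ (m + J)))"
      using prob_diam_gt[OF P \<open>1 \<le> m\<close> _ choose pack] d elim(2) n by simp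
    also have "\<dots> \<le> 2 * (2 ^ J * (2 ^ (m + J) * (1 / 8) ^ n)) + 2 ^ (m + J) * 2 ^ (m + J) * (1 / 8) ^ n"
    proof (intro add_mono mult_left_mono mult_mono power_decreasing d)
      \<comment> \<open>The factor 3 in \<open>hit\<close> makes the exponential at most
        \<open>exp (- 3) ^ n\<close>, comparable with the other error term because
        \<open>exp 3 \<ge> 8\<close>.\<close>
      have "3 * real n \<le> real (?d ^ (J + 1)) ^ 2 / 2 ^ (m + J)"
      proof -
        have "real (3 * n * 2 ^ (m + J)) \<le> real ((?d ^ (J + 1)) ^ 2)" using hit by (simp only: of_nat_le_iff)
        then show ?thesis by (simp add: pos_le_divide_eq)
      qed
      then have "exp (- (real (?d ^ (J + 1)) ^ 2 / 2 ^ (m + J))) \<le> exp (- (3 * real n))" by simp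
      also have "\<dots> = exp (- 3) ^ n" by (simp add: exp_of_nat_mult[symmetric])
      also have "\<dots> \<le> (1 / 8) ^ n"
      proof (rule power_mono)
        have "2 \<le> exp (1 :: real)" using exp_ge_add_one_self[of 1] by simp
        then have "2 ^ 3 \<le> exp (1 :: real) ^ 3" by (rule power_mono) simp
        then have "8 \<le> exp (3 :: real)" by (simp add: exp_of_nat_mult[symmetric])
        then show "exp (- 3) \<le> (1 / 8 :: real)" by (simp add: exp_minus field_simps)
      qed simp
      finally show "exp (- (real (?d ^ (J + 1)) ^ 2 / 2 ^ (m + J))) \<le> (1 / 8) ^ n" .
    qed auto
    \<comment> \<open>Both terms become \<open>4 ^ n * (1 / 8) ^ n\<close>; in the first, the
      leading 2 is absorbed by \<open>J + 1 \<le> n\<close>.\<close>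
    also have "\<dots> \<le> 2 ^ n * (2 ^ n * (1 / 8) ^ n) + 2 ^ n * 2 ^ n * (1 / 8) ^ n"
    proof (rule add_mono)
      have "2 * (2 ^ J * (2 ^ (m + J) * (1 / 8 :: real) ^ n)) = 2 ^ (J + 1) * (2 ^ (m + J) * (1 / 8) ^ n)" by simp
      also have "\<dots> \<le> 2 ^ n * (2 ^ n * (1 / 8) ^ n)"
        using n by (intro mult_mono power_increasing mult_right_mono) auto
      finally show "2 * (2 ^ J * (2 ^ (m + J) * (1 / 8 :: real) ^ n)) \<le> 2 ^ n * (2 ^ n * (1 / 8) ^ n)" .
      show "2 ^ (m + J) * 2 ^ (m + J) * (1 / 8 :: real) ^ n \<le> 2 ^ n * 2 ^ n * (1 / 8) ^ n"
        by (rule mult_right_mono) (use n in \<open>auto intro!: mult_mono power_increasing\<close>)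
    qed
    also have "\<dots> = 2 * (2 * 2 * (1 / 8)) ^ n" by (simp only: power_mult_distrib)
    finally show ?case using k by (intro exI[of _ "2 * (J + 1) * (r + 1)"]) simp
  qed
qed

theorem theorem1p1:
  fixes P :: "nat \<Rightarrow> bool list ugraph pmf"
  assumes "random_twisted_hypercube P"
  shows "\<forall>\<epsilon>::real. \<epsilon> > 0 \<longrightarrow>
    (\<lambda>n. measure_pmf.prob (P n)
       {G. \<bar>ereal_of_enat (diam G) - ereal (real n / log 2 (real n))\<bar>
             \<le> ereal (\<epsilon> * (real n / log 2 (real n)))}) \<longlonglongrightarrow> 1"
proof (intro allI impI)
  fix \<epsilon> :: real assume "\<epsilon> > 0"
  let ?E = "\<lambda>n. {G :: bool list ugraph. \<bar>ereal_of_enat (diam G) - ereal (real n / log 2 (real n))\<bar>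
             \<le> ereal (\<epsilon> * (real n / log 2 (real n)))}"
  \<comment> \<open>The ball bound has base \<open>n + 1\<close>; passing from
    \<open>log 2 (n + 1)\<close> to \<open>log 2 n\<close> costs less than the margin
    \<open>\<epsilon>\<close>.\<close>
  have lower: "\<forall>\<^sub>F n in sequentially. (1 - \<epsilon>) * (real n / log 2 (real n)) \<le> real n / log 2 (real n + 1)"
    using \<open>\<epsilon> > 0\<close> by real_asymp
  have bound: "\<forall>\<^sub>F n in sequentially. 1 - 2 * (1 / 2) ^ n \<le> measure_pmf.prob (P n) (?E n)"
    using eventually_prob_diam_gt[OF assms \<open>\<epsilon> > 0\<close>] lower eventually_ge_at_top[of 2]
  proof eventually_elim
    case (elim n)
    then obtain k where k: "real k \<le> (1 + \<epsilon>) * (real n / log 2 (real n))"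
      "measure_pmf.prob (P n) {G. \<not> diam G \<le> enat k} \<le> 2 * (1 / 2) ^ n" by blast
    \<comment> \<open>Only the upper bound can fail: the lower one holds on the whole
      support.\<close>
    have "1 - 2 * (1 / 2) ^ n \<le> 1 - measure_pmf.prob (P n) {G. \<not> diam G \<le> enat k}" using k(2) by simp
    also have "\<dots> = measure_pmf.prob (P n) {G. diam G \<le> enat k}"
      by (subst measure_pmf.prob_compl[symmetric]) (auto intro!: arg_cong[where f = "measure_pmf.prob _"])
    also have "\<dots> \<le> measure_pmf.prob (P n) (?E n)"
    proof (rule measure_pmf_mono)
      fix G assume G: "G \<in> set_pmf (P n)" "G \<in> {G. diam G \<le> enat k}"
      \<comment> \<open>The upper bound excludes an infinite diameter, so the comparison reduces to
        real numbers.\<close>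
      then obtain D where D: "diam G = enat D" "D \<le> k" by (cases "diam G") auto
      have cube: "twisted_cube n G"
        using random_twisted_hypercube_twisted_cube[OF assms _ G(1)] elim(3) by simp
      have "real (2 ^ n) \<le> real ((n + 1) ^ D)"
        using twisted_cube_diam_ge[OF cube D(1)] by (simp only: of_nat_le_iff)
      then have "(2 :: real) ^ n \<le> (real n + 1) ^ D" by (simp add: add.commute)
      then have "log 2 (2 ^ n) \<le> log 2 ((real n + 1) ^ D)" by (subst log_le_cancel_iff) auto
      then have "real n \<le> real D * log 2 (real n + 1)" by (simp add: log_nat_power add.commute)
      then have "real n / log 2 (real n + 1) \<le> real D"
        using elim(3) by (simp add: pos_divide_le_eq)
      then have "(1 - \<epsilon>) * (real n / log 2 (real n)) \<le> real D" using elim(2) by linarith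
      moreover have "real D \<le> (1 + \<epsilon>) * (real n / log 2 (real n))" using k(1) D(2) by linarith
      moreover have "\<bar>real D - y\<bar> \<le> \<epsilon> * y" if "(1 - \<epsilon>) * y \<le> real D" "real D \<le> (1 + \<epsilon>) * y" for y
        using that by (simp add: abs_le_iff algebra_simps)
      ultimately have "\<bar>real D - real n / log 2 (real n)\<bar> \<le> \<epsilon> * (real n / log 2 (real n))"
        by blast
      then show "G \<in> ?E n" by (simp add: D(1))
    qed
    finally show ?case .
  qed
  have lim: "(\<lambda>n. 1 - 2 * (1 / 2) ^ n :: real) \<longlonglongrightarrow> 1" by real_asymp
  show "(\<lambda>n. measure_pmf.prob (P n) (?E n)) \<longlonglongrightarrow> 1"
    by (rule tendsto_sandwich[OF bound _ lim tendsto_const]) simp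
qed

end
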